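(* Let $F\subset k[\mathbf{x}]=k[x_1,\ldots,x_n]$ be a Cremona set in degree $2$ satisfying the canonical restrictions and let $G=G_F$ be the corresponding graph, with unique circuit of length $r$, possibly degenerating to a loop ($r=1$). Let $s$ be the number of vertices of $G$ off the circuit whose vertex degree is $\geq 2$, and let $s_j$ be the number of edges in the $j$th neighborhood of the circuit. Let $F^{-1}\subset k[\mathbf{x}]$ denote the unique Cremona inverse set satisfying the canonical restrictions. The following conditions are equivalent: (a) The ideal $(F^{-1})\subset k[\mathbf{x}]$ is of linear type. (b) The ideal $(F)\subset k[\mathbf{x}]$ is linearly presented. (c) The edge-graph of $G$ has diameter $\leq 2$. (d) One of the following holds: $r=1$, $s_j=0$ for all $j\geq 3$, and $s\leq 1$; or $r=3$ and $s_j=0$ for all $j\geq 2$; or $r=5$ and $s_j=0$ for all $j\geq 1$.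
   Context: Let $k$ be a field and $n\ge 2$. For $v=(a_1,\ldots,a_n)\in\mathbb{N}^n$ write $\mathbf{x}^v=x_1^{a_1}\cdots x_n^{a_n}$. Let $F=\{\mathbf{x}^{v_1},\ldots,\mathbf{x}^{v_n}\}$ be a set of $n$ distinct monomials of the same degree; its log-matrix $A_F$ has $j$th column $v_j$. $F$ satisfies the canonical restrictions if the monomials have no non-trivial common factor and every variable divides at least one of them. $F$ is a Cremona set if the rational map $\mathbb{P}^{n-1}\dashrightarrow\mathbb{P}^{n-1}$ with coordinates $(\mathbf{x}^{v_1}:\cdots:\mathbf{x}^{v_n})$ is birational; it is in degree $2$ if the monomials have degree $2$. For a Cremona set $F$ satisfying the canonical restrictions, there are a unique set $F^{-1}$ of $n$ monomials of a common degree satisfying the canonical restrictions, with log-matrix $A_{F^{-1}}$, and a unique vector $\gamma\in\mathbb{N}^n$ such that $A_F\cdot A_{F^{-1}}=[\gamma|\cdots|\gamma]+I_n$; $F^{-1}$ defines the inverse map and is called the Cremona inverse set. For $F$ in degree $2$, the graph $G_F$ has vertices $x_1,\ldots,x_n$, an edge joining $x_i$ and $x_j$ for each $x_ix_j\in F$ ($i\ne j$) and a loop at $x_i$ for each $x_i^2\in F$. For a Cremona set in degree $2$ satisfying the canonical restrictions, $G_F$ is connected and is either a loopless graph with a unique circuit, of odd length $r\ge 3$, or a tree plus exactly one loop ($r=1$; the loop with its vertex plays the role of the circuit). The $j$th neighborhood of the circuit consists of the vertices at distance $j\ge1$ from the circuit, and its edges are those joining a vertex at distance $j-1$ to a vertex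 at distance $j$. The edge-graph of $G$ is the simple graph whose vertices are the edges of $G$ (a loop counts as an edge), two of them being adjacent if and only if the original edges meet. The diameter of a simple graph is the largest distance between two of its vertices, distance being the minimum number of edges in a path connecting them. An ideal $I$ is of linear type if the natural surjection from the symmetric algebra of $I$ to the Rees algebra of $I$ is an isomorphism. An ideal generated by forms of one degree is linearly presented if the module of syzygies of these forms is generated by linear syzygies. *)

theory Defs
  imports
    "HOL-Analysis.Analysis"
    "HOL-Library.Poly_Mapping"
    "HOL-Library.Extended_Nat"
    "HOL-Algebra.QuotRing"
    "HOL-Algebra.Ideal_Product"
begin

section \<open>Monomials and polynomials\<close>

text \<open>A monomial is given by its exponent vector, so multiplication of monomials is addition of
  exponents. For a finite type \<open>'n\<close> with \<open>n\<close> elements, \<open>('n, 'k) mpoly\<close> is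
  \<open>k[x_1, ..., x_n]\<close>; its ring operations are those of \<^theory>\<open>HOL-Library.Poly_Mapping\<close>.\<close>

type_synonym 'i monomial = "'i \<Rightarrow>\<^sub>0 nat"
type_synonym ('i, 'a) mpoly = "('i \<Rightarrow>\<^sub>0 nat) \<Rightarrow>\<^sub>0 'a"

definition mdeg :: "'i monomial \<Rightarrow> nat"
  where "mdeg m = (\<Sum>i\<in>Poly_Mapping.keys m. Poly_Mapping.lookup m i)"

definition mdivides :: "'i monomial \<Rightarrow> 'i monomial \<Rightarrow> bool"
  where "mdivides u m \<longleftrightarrow> (\<exists>w. m = u + w)"

definition mono_poly :: "'i monomial \<Rightarrow> ('i, 'a::comm_ring_1) mpoly"
  where "mono_poly m = Poly_Mapping.single m 1"

definition mvar :: "'i \<Rightarrow> ('i, 'a::comm_ring_1) mpoly"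
  where "mvar i = mono_poly (Poly_Mapping.single i 1)"

definition mconst :: "'a \<Rightarrow> ('i, 'a::comm_ring_1) mpoly"
  where "mconst a = Poly_Mapping.single 0 a"

definition is_form :: "nat \<Rightarrow> ('i, 'a::comm_ring_1) mpoly \<Rightarrow> bool"
  where "is_form d p \<longleftrightarrow> (\<forall>m\<in>Poly_Mapping.keys p. mdeg m = d)"

text \<open>The value of a polynomial at \<open>\<sigma>\<close>, the coefficients being mapped by \<open>c\<close> (in all uses
  below, a ring homomorphism).\<close>

definition meval :: "('a \<Rightarrow> 'b) \<Rightarrow> ('i \<Rightarrow> 'b) \<Rightarrow> ('i, 'a::comm_ring_1) mpoly \<Rightarrow> 'b::comm_ring_1"
  where "meval c \<sigma> p =
    (\<Sum>m\<in>Poly_Mapping.keys p. c (Poly_Mapping.lookup p m) *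
       (\<Prod>i\<in>Poly_Mapping.keys m. \<sigma> i ^ Poly_Mapping.lookup m i))"


section \<open>Rational maps between projective spaces\<close>

text \<open>A rational map from \<open>\<P>\<^sup>n\<^sup>-\<^sup>1\<close> to itself is represented by a nonzero tuple of \<open>n\<close> forms of
  one degree. Two tuples represent the same map iff they are proportional over the field of
  fractions. The composite of two maps is only defined if the substituted tuple is nonzero.
  All conditions are polynomial identities, so they are also correct over finite fields.\<close>

definition form_tuple :: "('n::finite \<Rightarrow> ('n, 'k::field) mpoly) \<Rightarrow> bool"
  where "form_tuple f \<longleftrightarrow> (\<exists>d. \<forall>i. is_form d (f i)) \<and> (\<exists>i. f i \<noteq> 0)"

definition same_rational_map ::
    "('n::finite \<Rightarrow> ('n, 'k::field) mpoly) \<Rightarrow> ('n \<Rightarrow> ('n, 'k) mpoly) \<Rightarrow> bool"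
  where "same_rational_map f g \<longleftrightarrow>
    form_tuple f \<and> form_tuple g \<and> (\<forall>i j. f i * g j = f j * g i)"

definition rat_comp ::
    "('n::finite \<Rightarrow> ('n, 'k::field) mpoly) \<Rightarrow> ('n \<Rightarrow> ('n, 'k) mpoly) \<Rightarrow> 'n \<Rightarrow> ('n, 'k) mpoly"
  where "rat_comp g f = (\<lambda>i. meval mconst f (g i))"

definition birational :: "('n::finite \<Rightarrow> ('n, 'k::field) mpoly) \<Rightarrow> bool"
  where "birational f \<longleftrightarrow> form_tuple f \<and>
    (\<exists>g. form_tuple g \<and> same_rational_map (rat_comp g f) mvar
                     \<and> same_rational_map (rat_comp f g) mvar)"


section \<open>Cremona sets\<close>

text \<open>A set of \<open>n\<close> monomials comes with a numbering, which the log-matrix and the rational map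
  depend on: it is an injective family indexed by \<open>'n\<close>. The field only enters through its type.\<close>

definition monomial_set :: "('n::finite \<Rightarrow> 'n monomial) \<Rightarrow> bool"
  where "monomial_set F \<longleftrightarrow> inj F \<and> (\<exists>d. \<forall>j. mdeg (F j) = d)"

definition cremona_set :: "'k::field itself \<Rightarrow> ('n::finite \<Rightarrow> 'n monomial) \<Rightarrow> bool"
  where "cremona_set _ F \<longleftrightarrow>
    monomial_set F \<and> birational (\<lambda>j. mono_poly (F j) :: ('n, 'k) mpoly)"

definition canonical_restrictions :: "('n::finite \<Rightarrow> 'n monomial) \<Rightarrow> bool"
  where "canonical_restrictions F \<longleftrightarrow>
    (\<forall>u. (\<forall>j. mdivides u (F j)) \<longrightarrow> u = 0) \<and>
    (\<forall>i. \<exists>j. mdivides (Poly_Mapping.single i 1) (F j))"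

definition log_matrix :: "('n::finite \<Rightarrow> 'n monomial) \<Rightarrow> nat ^ 'n ^ 'n"
  where "log_matrix F = (\<chi> i j. Poly_Mapping.lookup (F j) i)"

definition cremona_inverse ::
    "('n::finite \<Rightarrow> 'n monomial) \<Rightarrow> ('n \<Rightarrow> 'n monomial) \<Rightarrow> bool"
  where "cremona_inverse F F' \<longleftrightarrow>
    monomial_set F' \<and> canonical_restrictions F' \<and>
    (\<exists>\<gamma>::nat ^ 'n. log_matrix F ** log_matrix F' = (\<chi> i j. \<gamma> $ i) + mat 1)"


section \<open>Graphs with loops\<close>

text \<open>A graph is given by its set of edges; all elements of the type are vertices. The edge
  joining \<open>x\<close> and \<open>y\<close> is \<open>{x, y}\<close>, so a loop is a singleton.\<close>

definition monomial_graph :: "('n \<Rightarrow> 'n monomial) \<Rightarrow> 'n set set"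
  where "monomial_graph F =
    {{x, y} | x y. \<exists>j. F j = Poly_Mapping.single x 1 + Poly_Mapping.single y 1}"

text \<open>A circuit is given by its vertices in cyclic order. For length \<open>1\<close> the condition says that
  there is a loop; length \<open>2\<close> is excluded, as it would traverse one edge twice.\<close>

definition circuit :: "'a set set \<Rightarrow> 'a list \<Rightarrow> bool"
  where "circuit E c \<longleftrightarrow> c \<noteq> [] \<and> distinct c \<and> length c \<noteq> 2 \<and>
    (\<forall>i<length c. {c ! i, c ! (Suc i mod length c)} \<in> E)"

definition path_betw :: "('a \<Rightarrow> 'a \<Rightarrow> bool) \<Rightarrow> 'a \<Rightarrow> 'a \<Rightarrow> 'a list \<Rightarrow> bool"
  where "path_betw adj x y p \<longleftrightarrow>
    p \<noteq> [] \<and> hd p = x \<and> last p = y \<and> distinct p \<and> successively adj p"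

text \<open>The distance is \<open>\<infinity>\<close> if there is no path.\<close>

definition gdist :: "('a \<Rightarrow> 'a \<Rightarrow> bool) \<Rightarrow> 'a \<Rightarrow> 'a \<Rightarrow> enat"
  where "gdist adj x y = (INF p\<in>{p. path_betw adj x y p}. enat (length p - 1))"

definition graph_diameter :: "'a set \<Rightarrow> ('a \<Rightarrow> 'a \<Rightarrow> bool) \<Rightarrow> enat"
  where "graph_diameter V adj = (SUP x\<in>V. SUP y\<in>V. gdist adj x y)"

definition edge_graph_adj :: "'a set set \<Rightarrow> 'a set \<Rightarrow> 'a set \<Rightarrow> bool"
  where "edge_graph_adj E e f \<longleftrightarrow> e \<in> E \<and> f \<in> E \<and> e \<noteq> f \<and> e \<inter> f \<noteq> {}"

definition dist_to :: "'a set set \<Rightarrow> 'a set \<Rightarrow> 'a \<Rightarrow> enat"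
  where "dist_to E C x = (INF y\<in>C. gdist (\<lambda>u v. {u, v} \<in> E) x y)"

definition nbhd_edges :: "'a set set \<Rightarrow> 'a set \<Rightarrow> nat \<Rightarrow> 'a set set"
  where "nbhd_edges E C j =
    {{x, y} | x y. {x, y} \<in> E \<and> dist_to E C x = enat (j - 1) \<and> dist_to E C y = enat j}"

text \<open>A loop contributes \<open>2\<close> to the degree of its vertex.\<close>

definition vertex_degree :: "'a set set \<Rightarrow> 'a \<Rightarrow> nat"
  where "vertex_degree E x = card {e \<in> E. x \<in> e} + (if {x} \<in> E then 1 else 0)"


section \<open>Ideals of linear type and linear presentation\<close>

definition ring_on :: "'a::comm_ring_1 set \<Rightarrow> 'a ring"
  where "ring_on S = \<lparr>carrier = S, mult = (*), one = 1, zero = 0, add = (+)\<rparr>"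

definition ideal_of :: "'a::comm_ring_1 set \<Rightarrow> 'a set"
  where "ideal_of S = Idl\<^bsub>ring_on UNIV\<^esub> S"

primrec ideal_power :: "'a::comm_ring_1 set \<Rightarrow> nat \<Rightarrow> 'a set"
  where
    "ideal_power I 0 = UNIV"
  | "ideal_power I (Suc i) = ideal_prod (ring_on UNIV) (ideal_power I i) I"

text \<open>The symmetric algebra of an ideal \<open>I\<close> of \<open>R\<close>, as a module: the commutative \<open>R\<close>-algebra
  generated by symbols \<open>T_f\<close> (\<open>f \<in> I\<close>) subject to the relations
  \<open>T_(f + g) = T_f + T_g\<close> and \<open>T_(a f) = a T_f\<close>.\<close>

definition sym_free :: "'r::comm_ring_1 set \<Rightarrow> ('r, 'r) mpoly ring"
  where "sym_free I = ring_on {p. \<forall>m\<in>Poly_Mapping.keys p. Poly_Mapping.keys m \<subseteq> I}"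

definition sym_relations :: "'r::comm_ring_1 set \<Rightarrow> ('r, 'r) mpoly set"
  where "sym_relations I =
    {mvar (f + g) - mvar f - mvar g | f g. f \<in> I \<and> g \<in> I} \<union>
    {mvar (a * f) - mconst a * mvar f | a f. f \<in> I}"

definition symmetric_algebra :: "'r::comm_ring_1 set \<Rightarrow> ('r, 'r) mpoly set ring"
  where "symmetric_algebra I = sym_free I Quot (Idl\<^bsub>sym_free I\<^esub> (sym_relations I))"

text \<open>The Rees algebra \<open>R[I t]\<close>, the direct sum of the \<open>I\<^sup>i t\<^sup>i\<close>, inside \<open>R[t]\<close>.\<close>

definition rees_algebra :: "'r::comm_ring_1 set \<Rightarrow> 'r poly ring"
  where "rees_algebra I = ring_on {q. \<forall>i. poly.coeff q i \<in> ideal_power I i}"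

text \<open>The \<open>R\<close>-algebra map with \<open>T_f \<mapsto> f t\<close>, on residue classes: it is constant on each of them.\<close>

definition sym_to_rees :: "('r::comm_ring_1, 'r) mpoly set \<Rightarrow> 'r poly"
  where "sym_to_rees X = the_elem (meval (\<lambda>a. [:a:]) (\<lambda>f. [:0, f:]) ` X)"

definition linear_type :: "'r::comm_ring_1 set \<Rightarrow> bool"
  where "linear_type I \<longleftrightarrow> sym_to_rees \<in> ring_iso (symmetric_algebra I) (rees_algebra I)"

definition syzygies :: "('n::finite \<Rightarrow> ('n, 'k::field) mpoly) \<Rightarrow> (('n, 'k) mpoly ^ 'n) set"
  where "syzygies f = {z. (\<Sum>j\<in>UNIV. z $ j * f j) = 0}"

definition linearly_presented :: "('n::finite \<Rightarrow> ('n, 'k::field) mpoly) \<Rightarrow> bool"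
  where "linearly_presented f \<longleftrightarrow>
    module.span (*s) {z \<in> syzygies f. \<forall>j. is_form 1 (z $ j)} = syzygies f"

end

theory Submission
  imports Defs
begin

text \<open>The four conditions are all equivalent to the following property of the graph, called
  \<open>linked\<close> below: any two disjoint edges are joined by an edge.

  Let \<open>A\<close> and \<open>B\<close> be the log-matrices of \<open>F\<close> and of its inverse set, so that
  \<open>A B = [\<gamma>|...|\<gamma>] + I\<close>. This identity and the column sums of \<open>A\<close> imply that \<open>A\<close> is invertible
  over the reals (\<open>log_matrix_kernel\<close>). A multiset of edges is a monomial \<open>x^u\<close> in the variables of
  the inverse set, and a multiset of vertices is a monomial \<open>T^\<alpha>\<close> in its generators; multiplying
  exponents by \<open>A\<close>, two monomials \<open>x^u T^\<alpha>\<close> and \<open>x^v T^\<beta>\<close> with \<open>|\<alpha>| = |\<beta>|\<close> have the same image in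
  the Rees algebra iff \<open>A u + \<alpha> = A v + \<beta>\<close>, that is, iff replacing each edge by its ends makes them
  the same multiset of vertices. The relations of the symmetric algebra include the exchanges
  \<open>x_e T_c = x_f T_b\<close> for which the edge \<open>e\<close> and the vertex \<open>c\<close> have the same vertices as \<open>f\<close> and \<open>b\<close>.
  In a linked graph these exchanges connect any two monomials with the same image
  (\<open>relations_connected\<close>), which gives linear type. If \<open>e = ab\<close> and \<open>f = cd\<close> are disjoint and not
  linked, then \<open>x_e T_c T_d - x_f T_a T_b\<close> vanishes in the Rees algebra; but it has the value 1 at a
  point which is a zero of all relations of the symmetric algebra, where \<open>x_e\<close>, \<open>T_c\<close>, \<open>T_d\<close> are 1 and
  the other coordinates are 0 (\<open>linear_type_imp_linked\<close>).

  For the linear presentation, the syzygies of monomials are spanned by those of pairs of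
  generators. The syzygy of two edges with a common vertex is a multiple of a linear one, and that of
  two disjoint edges passes through a linking edge, if there is one; if there is none, then no linear
  syzygy has a multiple that contributes to it. For the edge-graph, the diameter is at most 2 iff the
  graph is linked by definition of the distance.

  For the shape of the graph, the columns of \<open>B\<close> satisfy \<open>A (b_x - b_y) = e_x - e_y\<close>, where \<open>e_x\<close>
  is the unit vector, and the parity of the entries over a component shows that the graph is
  connected; alternating signs along an even circuit would give a vector in the kernel of \<open>A\<close>, so
  circuits are odd. As there are as many edges as vertices, and each vertex off the circuit has an
  edge to a vertex closer to it, these edges and those of the circuit are all edges (\<open>edges_eq\<close>). With
  this description the linked graphs are found by inspection (\<open>linked_edges_iff\<close>).\<close>

abbreviation "lookup \<equiv> Poly_Mapping.lookup"
abbreviation "keys \<equiv> Poly_Mapping.keys"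
abbreviation "single \<equiv> Poly_Mapping.single"

section \<open>Evaluation of polynomials\<close>

text \<open>The additive extension to polynomials of a map that is given on terms.\<close>

definition lin_ext :: "('m \<Rightarrow> 'a \<Rightarrow> 'b::comm_monoid_add) \<Rightarrow> ('m \<Rightarrow>\<^sub>0 'a::comm_monoid_add) \<Rightarrow> 'b"
  where "lin_ext G p = (\<Sum>m\<in>keys p. G m (lookup p m))"

lemma lin_ext_superset:
  assumes "finite M" "keys p \<subseteq> M" "\<And>m. G m 0 = 0"
  shows "lin_ext G p = (\<Sum>m\<in>M. G m (lookup p m))"
  unfolding lin_ext_def
  by (rule sum.mono_neutral_left) (use assms in \<open>auto simp: in_keys_iff\<close>)

lemma lin_ext_zero [simp]: "lin_ext G 0 = 0"
  by (simp add: lin_ext_def)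

lemma lin_ext_add:
  assumes "\<And>m. G m 0 = 0" "\<And>m a b. G m (a + b) = G m a + G m b"
  shows "lin_ext G (p + q) = lin_ext G p + lin_ext G q"
proof -
  have "lin_ext G (p + q) = (\<Sum>m\<in>keys p \<union> keys q. G m (lookup (p + q) m))"
    by (rule lin_ext_superset) (use assms keys_add[of p q] in auto)
  also have "\<dots> = (\<Sum>m\<in>keys p \<union> keys q. G m (lookup p m)) + (\<Sum>m\<in>keys p \<union> keys q. G m (lookup q m))"
    by (simp add: lookup_add assms sum.distrib)
  also have "\<dots> = lin_ext G p + lin_ext G q"
    using lin_ext_superset[of "keys p \<union> keys q" p G] lin_ext_superset[of "keys p \<union> keys q" q G] assms
    by auto
  finally show ?thesis .
qed

lemma lin_ext_single:
  assumes "\<And>m. G m 0 = 0"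
  shows "lin_ext G (single m a) = G m a"
  using assms by (cases "a = 0") (auto simp: lin_ext_def)

lemma sum_singles:
  fixes p :: "'m \<Rightarrow>\<^sub>0 'a::comm_monoid_add"
  shows "(\<Sum>m\<in>keys p. single m (lookup p m)) = p"
  by (rule poly_mapping_eqI)
     (auto simp: lookup_sum lookup_single when_def sum.delta in_keys_iff)

lemma poly_mapping_single_induct [case_names zero single add]:
  fixes p :: "'m \<Rightarrow>\<^sub>0 'a::comm_monoid_add"
  assumes "P 0" "\<And>m a. a \<noteq> 0 \<Longrightarrow> m \<in> keys p \<Longrightarrow> P (single m a)" "\<And>p q. P p \<Longrightarrow> P q \<Longrightarrow> P (p + q)"
  shows "P p"
proof -
  have "P (\<Sum>m\<in>M. single m (lookup p m))" if "finite M" "M \<subseteq> keys p" for M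
    using that by (induction M rule: finite_induct) (auto simp: assms in_keys_iff)
  from this[of "keys p"] show ?thesis by (simp add: sum_singles)
qed

definition ring_map :: "('a::comm_ring_1 \<Rightarrow> 'b::comm_ring_1) \<Rightarrow> bool"
  where "ring_map c \<longleftrightarrow> c 1 = 1 \<and> (\<forall>a b. c (a + b) = c a + c b) \<and> (\<forall>a b. c (a * b) = c a * c b)"

lemma ring_mapD:
  assumes "ring_map c"
  shows "c 1 = 1" "c (a + b) = c a + c b" "c (a * b) = c a * c b" "c 0 = 0" "c (- a) = - c a"
    "c (a - b) = c a - c b"
proof -
  show 1: "c 1 = 1" and 2: "c (a + b) = c a + c b" and "c (a * b) = c a * c b" for a b
    using assms by (auto simp: ring_map_def)
  show 3: "c 0 = 0" using 2[of 0 0] by simp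
  show 4: "c (- a) = - c a" for a using 2[of a "- a"] 3 by (simp add: eq_neg_iff_add_eq_0 add.commute)
  show "c (a - b) = c a - c b" using 2[of a "- b"] 4 by simp
qed

definition monval :: "('i \<Rightarrow> 'b::comm_ring_1) \<Rightarrow> 'i monomial \<Rightarrow> 'b"
  where "monval \<sigma> m = (\<Prod>i\<in>keys m. \<sigma> i ^ lookup m i)"

lemma monval_zero [simp]: "monval \<sigma> 0 = 1"
  by (simp add: monval_def)

lemma monval_superset:
  assumes "finite S" "keys m \<subseteq> S"
  shows "monval \<sigma> m = (\<Prod>i\<in>S. \<sigma> i ^ lookup m i)"
  unfolding monval_def by (rule prod.mono_neutral_left) (use assms in \<open>auto simp: in_keys_iff\<close>)

lemma monval_add: "monval \<sigma> (m + m') = monval \<sigma> m * monval \<sigma> m'"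
proof -
  let ?S = "keys m \<union> keys m'"
  have "monval \<sigma> (m + m') = (\<Prod>i\<in>?S. \<sigma> i ^ lookup (m + m') i)"
    by (rule monval_superset) (use keys_add[of m m'] in auto)
  also have "\<dots> = monval \<sigma> m * monval \<sigma> m'"
    by (simp add: lookup_add power_add prod.distrib monval_superset[of ?S])
  finally show ?thesis .
qed

lemma monval_single [simp]: "monval \<sigma> (single i k) = \<sigma> i ^ k"
  by (cases "k = 0") (auto simp: monval_def)

lemma meval_eq_lin_ext: "meval c \<sigma> p = lin_ext (\<lambda>m a. c a * monval \<sigma> m) p"
  by (simp add: meval_def lin_ext_def monval_def)

context
  fixes c :: "'a::comm_ring_1 \<Rightarrow> 'b::comm_ring_1" assumes c: "ring_map c"
begin

lemma meval_add: "meval c \<sigma> (p + q) = meval c \<sigma> p + meval c \<sigma> q"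
  unfolding meval_eq_lin_ext
  by (rule lin_ext_add) (simp_all add: ring_mapD[OF c] algebra_simps)

lemma meval_single: "meval c \<sigma> (single m a) = c a * monval \<sigma> m"
  unfolding meval_eq_lin_ext by (rule lin_ext_single) (simp add: ring_mapD[OF c])

lemma meval_zero: "meval c \<sigma> 0 = 0"
  by (simp add: meval_eq_lin_ext)

lemma meval_mult: "meval c \<sigma> (p * q) = meval c \<sigma> p * meval c \<sigma> q"
proof (induction p rule: poly_mapping_single_induct)
  case (single m a)
  show ?case
  proof (induction q rule: poly_mapping_single_induct)
    case (single m' a')
    then show ?case
      by (simp add: mult_single meval_single monval_add ring_mapD[OF c] algebra_simps)
  qed (simp_all add: meval_zero meval_add algebra_simps)
qed (simp_all add: meval_zero meval_add algebra_simps)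

lemma ring_map_meval: "ring_map (meval c \<sigma>)"
  using meval_single[of \<sigma> 0 1]
  by (auto simp: ring_map_def meval_add meval_mult ring_mapD[OF c])

lemma meval_mconst: "meval c \<sigma> (mconst a) = c a"
  by (simp add: mconst_def meval_single)

lemma meval_mono_poly: "meval c \<sigma> (mono_poly m) = monval \<sigma> m"
  by (simp add: mono_poly_def meval_single ring_mapD[OF c])

lemma meval_mvar: "meval c \<sigma> (mvar i) = \<sigma> i"
  by (simp add: mvar_def meval_mono_poly)

end

lemma ring_map_id: "ring_map (\<lambda>x. x)"
  by (simp add: ring_map_def)

lemma ring_map_const_poly: "ring_map (\<lambda>a. [:a:])"
  by (simp add: ring_map_def one_pCons)

lemma ring_map_mconst: "ring_map (mconst :: 'a \<Rightarrow> ('i, 'a::comm_ring_1) mpoly)"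
  by (simp add: ring_map_def mconst_def single_add mult_single)

lemma mono_poly_add: "mono_poly (m + m') = mono_poly m * mono_poly m'"
  by (simp add: mono_poly_def mult_single)

lemma mconst_mult_mono_poly: "mconst a * mono_poly m = single m a"
  by (simp add: mono_poly_def mconst_def mult_single)

lemma single_eq_monval: "single m a = mconst a * monval mvar m"
proof -
  have "monval mvar m = (mono_poly m :: ('a, 'b) mpoly)" for m :: "'a monomial"
  proof (induction m rule: poly_mapping_single_induct)
    case (single i k)
    have "mvar i ^ k = (mono_poly (single i k) :: ('a, 'b) mpoly)"
      by (induction k) (simp_all add: mono_poly_def mvar_def mult_single single_add[symmetric])
    then show ?case by simp
  qed (simp_all add: monval_add mono_poly_def mult_single)
  then show ?thesis by (simp add: mconst_mult_mono_poly)
qed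

section \<open>Subrings and ideals\<close>

lemma ring_on_simps [simp]:
  "carrier (ring_on S) = S" "mult (ring_on S) = (*)" "one (ring_on S) = 1"
  "zero (ring_on S) = 0" "add (ring_on S) = (+)"
  by (simp_all add: ring_on_def)

lemma cring_ring_on:
  fixes S :: "'a::comm_ring_1 set"
  assumes "1 \<in> S" "0 \<in> S" "\<And>x. x \<in> S \<Longrightarrow> - x \<in> S"
    "\<And>x y. x \<in> S \<Longrightarrow> y \<in> S \<Longrightarrow> x + y \<in> S" "\<And>x y. x \<in> S \<Longrightarrow> y \<in> S \<Longrightarrow> x * y \<in> S"
  shows "cring (ring_on S)"
proof (rule cringI)
  show "abelian_group (ring_on S)"
  proof (rule abelian_groupI, goal_cases)
    case (6 x) then show ?case by (auto intro!: bexI[of _ "- x"] assms)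
  qed (auto simp: assms algebra_simps)
  show "comm_monoid (ring_on S)"
    by (rule comm_monoidI) (auto simp: assms algebra_simps)
qed (auto simp: algebra_simps)

lemma ideal_ring_onI:
  assumes "ring (ring_on S)" "J \<subseteq> S" "0 \<in> J"
    "\<And>x y. x \<in> J \<Longrightarrow> y \<in> J \<Longrightarrow> x + y \<in> J" "\<And>a x. a \<in> S \<Longrightarrow> x \<in> J \<Longrightarrow> a * x \<in> J"
  shows "ideal J (ring_on S)"
proof -
  interpret R: ring "ring_on S" by fact
  have m1: "- 1 \<in> S"
  proof -
    have "\<ominus>\<^bsub>ring_on S\<^esub> 1 \<in> S" "\<ominus>\<^bsub>ring_on S\<^esub> 1 + 1 = 0"
      using R.a_inv_closed[OF R.one_closed] R.l_neg[OF R.one_closed] by auto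
    then show ?thesis by (simp add: eq_neg_iff_add_eq_0[symmetric])
  qed
  show ?thesis
  proof (rule idealI)
    show "subgroup J (add_monoid (ring_on S))"
    proof (rule group.subgroupI[OF R.a_group])
      show "J \<noteq> {}" using assms(3) by auto
      fix x assume x: "x \<in> J"
      then have "x \<in> S" using assms by auto
      then have "\<ominus>\<^bsub>ring_on S\<^esub> x + x = 0" using R.l_neg by auto
      then have "\<ominus>\<^bsub>ring_on S\<^esub> x = - 1 * x" by (simp add: eq_neg_iff_add_eq_0)
      then show "inv\<^bsub>add_monoid (ring_on S)\<^esub> x \<in> J"
        using assms(5)[OF m1 x] by (simp add: a_inv_def)
    qed (use assms in auto)
    fix a x assume "a \<in> J" "x \<in> carrier (ring_on S)"
    then show "x \<otimes>\<^bsub>ring_on S\<^esub> a \<in> J" "a \<otimes>\<^bsub>ring_on S\<^esub> x \<in> J"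
      using assms(5)[of x a] by (simp_all add: mult.commute[of a x])
  qed fact
qed

lemma ideal_ring_onD:
  assumes "ideal J (ring_on S)"
  shows "J \<subseteq> S" "0 \<in> J" "\<And>x y. x \<in> J \<Longrightarrow> y \<in> J \<Longrightarrow> x + y \<in> J"
    "\<And>a x. a \<in> S \<Longrightarrow> x \<in> J \<Longrightarrow> a * x \<in> J" "\<And>x. x \<in> J \<Longrightarrow> - x \<in> J"
    "\<And>x y. x \<in> J \<Longrightarrow> y \<in> J \<Longrightarrow> x - y \<in> J"
proof -
  interpret ideal J "ring_on S" by fact
  show "J \<subseteq> S" using Icarr by auto
  show "0 \<in> J" using additive_subgroup.zero_closed[OF ideal.axioms(1)[OF assms]] by simp
  show add: "\<And>x y. x \<in> J \<Longrightarrow> y \<in> J \<Longrightarrow> x + y \<in> J" using additive_subgroup.a_closed[OF ideal.axioms(1)[OF assms]] by simp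
  show mult: "\<And>a x. a \<in> S \<Longrightarrow> x \<in> J \<Longrightarrow> a * x \<in> J" using I_l_closed by simp
  have "\<ominus>\<^bsub>ring_on S\<^esub> 1 \<in> S" "\<ominus>\<^bsub>ring_on S\<^esub> 1 + 1 = 0"
    using a_inv_closed[OF one_closed] l_neg[OF one_closed] by auto
  then have "- 1 \<in> S" by (simp add: eq_neg_iff_add_eq_0[symmetric])
  from mult[OF this] show neg: "\<And>x. x \<in> J \<Longrightarrow> - x \<in> J" by simp
  show "\<And>x y. x \<in> J \<Longrightarrow> y \<in> J \<Longrightarrow> x - y \<in> J" using add neg by (metis diff_conv_add_uminus)
qed

lemma cring_ring_on_UNIV: "cring (ring_on UNIV)"
  by (rule cring_ring_on) auto

lemma ideal_ideal_of: "ideal (ideal_of S) (ring_on UNIV)"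
  unfolding ideal_of_def
  by (rule ring.genideal_ideal) (auto intro: cring.axioms cring_ring_on_UNIV)

lemma mem_ideal_of_range_iff:
  fixes g :: "'n::finite \<Rightarrow> 'r::comm_ring_1"
  shows "f \<in> ideal_of (range g) \<longleftrightarrow> (\<exists>a. f = (\<Sum>j\<in>UNIV. a j * g j))"
proof
  interpret U: cring "ring_on (UNIV::'r set)" by (rule cring_ring_on_UNIV)
  let ?J = "{f. \<exists>a. f = (\<Sum>j\<in>UNIV. a j * g j)}"
  have "ideal ?J (ring_on UNIV)"
  proof (rule ideal_ring_onI)
    show "0 \<in> ?J" by (auto intro: exI[of _ "\<lambda>_. 0"])
    fix x y assume "x \<in> ?J" "y \<in> ?J"
    then obtain a b where "x = (\<Sum>j\<in>UNIV. a j * g j)" "y = (\<Sum>j\<in>UNIV. b j * g j)" by auto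
    then show "x + y \<in> ?J"
      by (auto intro!: exI[of _ "\<lambda>j. a j + b j"] simp: algebra_simps sum.distrib)
  next
    fix c x assume "x \<in> ?J"
    then obtain a where "x = (\<Sum>j\<in>UNIV. a j * g j)" by auto
    then show "c * x \<in> ?J"
      by (auto intro!: exI[of _ "\<lambda>j. c * a j"] simp: algebra_simps sum_distrib_left)
  qed (auto intro: U.ring_axioms)
  moreover have "range g \<subseteq> ?J"
  proof -
    have "g j = (\<Sum>i\<in>UNIV. (if i = j then 1 else 0) * g i)" for j
      by (simp add: mult_delta_left)
    then show ?thesis by (intro subsetI CollectI) (metis rangeE)
  qed
  ultimately have "ideal_of (range g) \<subseteq> ?J"
    unfolding ideal_of_def by (rule U.genideal_minimal)
  then show "f \<in> ideal_of (range g) \<Longrightarrow> \<exists>a. f = (\<Sum>j\<in>UNIV. a j * g j)" by auto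
next
  interpret U: cring "ring_on (UNIV::'r set)" by (rule cring_ring_on_UNIV)
  note D = ideal_ring_onD[OF ideal_ideal_of[of "range g"]]
  have g: "g j \<in> ideal_of (range g)" for j
    unfolding ideal_of_def using U.genideal_self[of "range g"] by auto
  assume "\<exists>a. f = (\<Sum>j\<in>UNIV. a j * g j)"
  then obtain a where f: "f = (\<Sum>j\<in>UNIV. a j * g j)" by auto
  have "(\<Sum>j\<in>M. a j * g j) \<in> ideal_of (range g)" for M
    by (induction M rule: infinite_finite_induct) (auto intro: D g)
  then show "f \<in> ideal_of (range g)" by (simp add: f)
qed

lemma ideal_ideal_power:
  assumes "ideal I (ring_on UNIV)"
  shows "ideal (ideal_power I i) (ring_on UNIV)"
proof -
  interpret U: cring "ring_on (UNIV::'a set)" by (rule cring_ring_on_UNIV)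
  show ?thesis
    by (induction i) (use assms U.oneideal in \<open>auto intro: U.ideal_prod_is_ideal\<close>)
qed

section \<open>Symmetric algebra and Rees algebra\<close>

abbreviation to_rees :: "('r::comm_ring_1, 'r) mpoly \<Rightarrow> 'r poly"
  where "to_rees \<equiv> meval (\<lambda>a. [:a:]) (\<lambda>f. [:0, f:])"

lemma sym_free_eq: "sym_free I = ring_on (carrier (sym_free I))"
  by (simp add: sym_free_def)

lemma carrier_sym_free: "carrier (sym_free I) = {p. \<forall>m\<in>keys p. keys m \<subseteq> I}"
  by (simp add: sym_free_def)

lemma sym_free_closed:
  shows "1 \<in> carrier (sym_free I)" "0 \<in> carrier (sym_free I)" "mconst a \<in> carrier (sym_free I)"
    "f \<in> I \<Longrightarrow> mvar f \<in> carrier (sym_free I)"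
    "x \<in> carrier (sym_free I) \<Longrightarrow> - x \<in> carrier (sym_free I)"
    "x \<in> carrier (sym_free I) \<Longrightarrow> y \<in> carrier (sym_free I) \<Longrightarrow> x + y \<in> carrier (sym_free I)"
    "x \<in> carrier (sym_free I) \<Longrightarrow> y \<in> carrier (sym_free I) \<Longrightarrow> x - y \<in> carrier (sym_free I)"
    "x \<in> carrier (sym_free I) \<Longrightarrow> y \<in> carrier (sym_free I) \<Longrightarrow> x * y \<in> carrier (sym_free I)"
proof -
  show neg: "x \<in> carrier (sym_free I) \<Longrightarrow> - x \<in> carrier (sym_free I)" for x
    by (auto simp: carrier_sym_free in_keys_iff)
  show add: "x \<in> carrier (sym_free I) \<Longrightarrow> y \<in> carrier (sym_free I) \<Longrightarrow> x + y \<in> carrier (sym_free I)" for x y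
    using keys_add[of x y] by (fastforce simp: carrier_sym_free)
  show "x \<in> carrier (sym_free I) \<Longrightarrow> y \<in> carrier (sym_free I) \<Longrightarrow> x - y \<in> carrier (sym_free I)"
    using add[OF _ neg, of x y] by simp
  show "x * y \<in> carrier (sym_free I)"
    if x: "x \<in> carrier (sym_free I)" and y: "y \<in> carrier (sym_free I)"
    unfolding carrier_sym_free
  proof (intro CollectI ballI)
    fix m assume "m \<in> keys (x * y)"
    then obtain a b where "m = a + b" "a \<in> keys x" "b \<in> keys y" using keys_mult[of x y] by auto
    then show "keys m \<subseteq> I" using x y keys_add[of a b] unfolding carrier_sym_free by blast
  qed
qed (auto simp: carrier_sym_free mconst_def mvar_def mono_poly_def)

lemma cring_sym_free: "cring (sym_free I)"
  by (subst sym_free_eq, rule cring_ring_on) (auto intro: sym_free_closed)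

lemma sym_free_induct [consumes 1, case_names const var add mult]:
  assumes "p \<in> carrier (sym_free I)"
    and const: "\<And>a. P (mconst a)" and var: "\<And>f. f \<in> I \<Longrightarrow> P (mvar f)"
    and add: "\<And>p q. p \<in> carrier (sym_free I) \<Longrightarrow> q \<in> carrier (sym_free I) \<Longrightarrow> P p \<Longrightarrow> P q \<Longrightarrow> P (p + q)"
    and mult: "\<And>p q. p \<in> carrier (sym_free I) \<Longrightarrow> q \<in> carrier (sym_free I) \<Longrightarrow> P p \<Longrightarrow> P q \<Longrightarrow> P (p * q)"
  shows "P p"
proof -
  let ?C = "carrier (sym_free I)"
  let ?Q = "\<lambda>p. p \<in> ?C \<and> P p"
  have one: "P 1" using const[of 1] by (simp add: mconst_def)
  have "?Q (mvar f ^ k)" if "f \<in> I" for f k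
    by (induction k) (auto simp: one that intro!: mult var sym_free_closed)
  then have "?Q (\<Prod>f\<in>M. mvar f ^ k f)" if "M \<subseteq> I" for M k
    using that by (induction M rule: infinite_finite_induct) (auto simp: one intro!: mult sym_free_closed)
  note prod = this
  have *: "?Q (single m a)" if m: "m \<in> keys p" for m a
  proof -
    have "keys m \<subseteq> I" using m assms(1) by (auto simp: carrier_sym_free)
    from prod[OF this] show ?thesis
      unfolding single_eq_monval monval_def by (auto intro!: mult const sym_free_closed)
  qed
  have "?Q p"
  proof (rule poly_mapping_single_induct[of ?Q])
    show "?Q 0" using const[of 0] by (simp add: mconst_def sym_free_closed)
  qed (auto simp: * intro: add sym_free_closed)
  then show ?thesis by simp
qed

lemma monval_mem_sym_free:
  assumes "\<And>i. \<sigma> i \<in> carrier (sym_free I)"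
  shows "monval \<sigma> m \<in> carrier (sym_free I)"
proof -
  have "x ^ k \<in> carrier (sym_free I)" if "x \<in> carrier (sym_free I)" for x k
    using that by (induction k) (auto intro: sym_free_closed)
  then have "(\<Prod>i\<in>M. \<sigma> i ^ lookup m i) \<in> carrier (sym_free I)" for M
    by (induction M rule: infinite_finite_induct) (auto intro!: sym_free_closed assms)
  then show ?thesis by (simp add: monval_def)
qed

lemma carrier_rees_algebra: "carrier (rees_algebra I) = {q. \<forall>i. poly.coeff q i \<in> ideal_power I i}"
  by (simp add: rees_algebra_def)

lemma ring_map_to_rees: "ring_map to_rees"
  by (rule ring_map_meval[OF ring_map_const_poly])

lemma to_rees_mconst [simp]: "to_rees (mconst a) = [:a:]"
  by (rule meval_mconst[OF ring_map_const_poly])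

lemma to_rees_mvar [simp]: "to_rees (mvar f) = [:0, f:]"
  by (rule meval_mvar[OF ring_map_const_poly])

lemma image_to_rees_closed:
  shows "1 \<in> to_rees ` carrier (sym_free I)" "0 \<in> to_rees ` carrier (sym_free I)"
    "x \<in> to_rees ` carrier (sym_free I) \<Longrightarrow> y \<in> to_rees ` carrier (sym_free I) \<Longrightarrow> x + y \<in> to_rees ` carrier (sym_free I)"
    "x \<in> to_rees ` carrier (sym_free I) \<Longrightarrow> y \<in> to_rees ` carrier (sym_free I) \<Longrightarrow> x * y \<in> to_rees ` carrier (sym_free I)"
    "x \<in> to_rees ` carrier (sym_free I) \<Longrightarrow> - x \<in> to_rees ` carrier (sym_free I)"
proof -
  note hom = ring_mapD[OF ring_map_to_rees]
  show "1 \<in> to_rees ` carrier (sym_free I)"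
    using hom(1) sym_free_closed(1)[of I] by (metis image_eqI)
  show "0 \<in> to_rees ` carrier (sym_free I)"
    using hom(4) sym_free_closed(2)[of I] by (metis image_eqI)
  show "x + y \<in> to_rees ` carrier (sym_free I)" "x * y \<in> to_rees ` carrier (sym_free I)"
    if "x \<in> to_rees ` carrier (sym_free I)" "y \<in> to_rees ` carrier (sym_free I)"
  proof -
    from that obtain p q where pq: "p \<in> carrier (sym_free I)" "q \<in> carrier (sym_free I)"
      "x = to_rees p" "y = to_rees q" by blast
    show "x + y \<in> to_rees ` carrier (sym_free I)"
      unfolding pq hom(2)[symmetric] by (intro imageI sym_free_closed pq)
    show "x * y \<in> to_rees ` carrier (sym_free I)"
      unfolding pq hom(3)[symmetric] by (intro imageI sym_free_closed pq)
  qed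
  show "- x \<in> to_rees ` carrier (sym_free I)" if "x \<in> to_rees ` carrier (sym_free I)"
  proof -
    from that obtain p where p: "p \<in> carrier (sym_free I)" "x = to_rees p" by blast
    show ?thesis unfolding p hom(5)[symmetric] by (intro imageI sym_free_closed p)
  qed
qed

text \<open>A product of \<open>i\<close> elements of \<open>I\<close>, times \<open>t^i\<close>, is the image of the product of the
  corresponding symbols. Conversely, multiplication by a generator's image \<open>f t\<close> moves the coefficients
  one power of \<open>I\<close> up, so it preserves the Rees algebra.\<close>

lemma image_to_rees:
  fixes I :: "'r::comm_ring_1 set"
  assumes I: "ideal I (ring_on UNIV)"
  shows "to_rees ` carrier (sym_free I) = carrier (rees_algebra I)"
proof (intro equalityI subsetI)
  note pw = ideal_ring_onD[OF ideal_ideal_power[OF I]]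
  fix q assume "q \<in> to_rees ` carrier (sym_free I)"
  then obtain p where p: "p \<in> carrier (sym_free I)" and q: "q = to_rees p" by auto
  from p have "\<forall>q\<in>carrier (rees_algebra I). to_rees p * q \<in> carrier (rees_algebra I)"
  proof (induction p rule: sym_free_induct)
    case (var f)
    have "poly.coeff ([:0, f:] * q) i \<in> ideal_power I i"
      if "\<forall>i. poly.coeff q i \<in> ideal_power I i" for q :: "'r poly" and i
      using that ideal_prod.prod[of "poly.coeff q (i - 1)" "ideal_power I (i - 1)" f I "ring_on UNIV"] var
      by (cases i) (auto simp: coeff_pCons mult.commute[of f] pw(2))
    then show ?case by (auto simp: carrier_rees_algebra)
  next
    case (mult p1 p2)
    then show ?case by (simp add: ring_mapD[OF ring_map_to_rees] mult.assoc)
  next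
    case (const a)
    show ?case by (auto simp: carrier_rees_algebra intro!: pw(4))
  next
    case (add p1 p2)
    then show ?case
      unfolding carrier_rees_algebra ring_mapD[OF ring_map_to_rees] distrib_right
      by (auto intro: pw(3))
  qed
  moreover have "1 \<in> carrier (rees_algebra I)"
    unfolding carrier_rees_algebra mem_Collect_eq
  proof
    show "poly.coeff 1 i \<in> ideal_power I i" for i by (cases i) (auto simp del: ideal_power.simps(2) intro: pw(2))
  qed
  ultimately have "to_rees p * 1 \<in> carrier (rees_algebra I)" by (rule bspec)
  then show "q \<in> carrier (rees_algebra I)" by (simp add: q)
next
  let ?S = "to_rees ` carrier (sym_free I)"
  note add = image_to_rees_closed(3)[of _ I] and mult = image_to_rees_closed(4)[of _ I]
  have const: "[:a:] \<in> ?S" for a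
    by (rule image_eqI[OF _ sym_free_closed(3)[of a]]) simp
  have var: "[:0, f:] \<in> ?S" if "f \<in> I" for f
    by (rule image_eqI[OF _ sym_free_closed(4)[OF that]]) simp
  have mon: "Polynomial.monom a i \<in> ?S" if "a \<in> ideal_power I i" for a i
    using that
  proof (induction i arbitrary: a)
    case 0
    then show ?case using const by (simp add: monom_0)
  next
    case (Suc i)
    from Suc.prems have "a \<in> ideal_prod (ring_on UNIV) (ideal_power I i) I" by simp
    then show ?case
    proof (induction rule: ideal_prod.induct)
      case (prod a f)
      then show ?case using mult[OF Suc.IH[OF prod(1)] var[OF prod(2)]]
        by (simp add: monom_Suc mult.commute[of a] smult_monom mult_monom)
    next
      case (sum a b)
      then show ?case using add by (simp add: add_monom[symmetric])
    qed
  qed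
  fix q assume q: "q \<in> carrier (rees_algebra I)"
  have "(\<Sum>i\<in>M. Polynomial.monom (poly.coeff q i) i) \<in> ?S" if "finite M" for M
    using that
  proof (induction M rule: finite_induct)
    case empty
    show ?case using const[of 0] by simp
  next
    case (insert x M)
    then show ?case using q by (auto intro!: add mon simp: carrier_rees_algebra)
  qed
  from this[of "{..Polynomial.degree q}"] show "q \<in> ?S"
    by (simp add: poly_as_sum_of_monoms)
qed

lemma cring_rees_algebra:
  fixes I :: "'r::comm_ring_1 set"
  assumes I: "ideal I (ring_on UNIV)"
  shows "cring (rees_algebra I)"
proof -
  let ?C = "carrier (sym_free I)"
  have "cring (ring_on (to_rees ` ?C))"
    by (rule cring_ring_on) (rule image_to_rees_closed; assumption?)+
  then show ?thesis
    by (simp add: image_to_rees[OF I] rees_algebra_def)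
qed

lemma ring_hom_to_rees:
  assumes I: "ideal I (ring_on UNIV)"
  shows "ring_hom_ring (sym_free I) (rees_algebra I) to_rees"
proof (rule ring_hom_ringI)
  show "to_rees x \<in> carrier (rees_algebra I)" if "x \<in> carrier (sym_free I)" for x
    using that image_to_rees[OF I] by auto
qed (auto intro: cring.axioms(1) cring_sym_free cring_rees_algebra[OF I],
     auto simp: sym_free_def rees_algebra_def ring_mapD[OF ring_map_to_rees])

lemma sym_relations_subset:
  assumes "ideal I (ring_on UNIV)"
  shows "sym_relations I \<subseteq> carrier (sym_free I)"
  using ideal_ring_onD[OF assms]
  by (auto simp: sym_relations_def intro!: sym_free_closed)

lemma ideal_sym_relations:
  assumes "ideal I (ring_on UNIV)"
  shows "ideal (Idl\<^bsub>sym_free I\<^esub> (sym_relations I)) (sym_free I)"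
  by (rule ring.genideal_ideal[OF cring.axioms(1)[OF cring_sym_free] sym_relations_subset[OF assms]])

text \<open>The universal property of the symmetric algebra: a map \<open>\<psi>\<close> on the ideal that is linear over \<open>c\<close>
  extends to it. It serves to show that an element is not a consequence of the relations.\<close>

lemma sym_relations_kernel:
  fixes I :: "'r::comm_ring_1 set" and c :: "'r \<Rightarrow> 'b::comm_ring_1"
  assumes I: "ideal I (ring_on UNIV)" and c: "ring_map c"
    and add: "\<And>f g. f \<in> I \<Longrightarrow> g \<in> I \<Longrightarrow> \<psi> (f + g) = \<psi> f + \<psi> g"
    and mult: "\<And>a f. f \<in> I \<Longrightarrow> \<psi> (a * f) = c a * \<psi> f"
    and p: "p \<in> Idl\<^bsub>sym_free I\<^esub> (sym_relations I)"
  shows "meval c \<psi> p = 0"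
proof -
  let ?K = "{p \<in> carrier (sym_free I). meval c \<psi> p = 0}"
  note hom = ring_mapD[OF ring_map_meval[OF c]]
  have R: "ring (sym_free I)" by (rule cring.axioms(1)[OF cring_sym_free])
  have "ideal ?K (ring_on (carrier (sym_free I)))"
    by (rule ideal_ring_onI) (auto simp: sym_free_eq[symmetric] R hom intro!: sym_free_closed)
  moreover have "sym_relations I \<subseteq> ?K"
    using sym_relations_subset[OF I]
    by (auto simp: sym_relations_def hom meval_mvar[OF c] meval_mconst[OF c] add mult)
  ultimately have "Idl\<^bsub>sym_free I\<^esub> (sym_relations I) \<subseteq> ?K"
    using ring.genideal_minimal[OF R, of ?K] by (simp add: sym_free_eq[symmetric])
  then show ?thesis using p by auto
qed

text \<open>The map from the symmetric algebra is a well-defined surjective homomorphism for every ideal, so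
  only its injectivity is at stake.\<close>

theorem linear_type_iff:
  fixes I :: "'r::comm_ring_1 set"
  assumes I: "ideal I (ring_on UNIV)"
  shows "linear_type I \<longleftrightarrow>
    (\<forall>p\<in>carrier (sym_free I). to_rees p = 0 \<longrightarrow> p \<in> Idl\<^bsub>sym_free I\<^esub> (sym_relations I))"
proof -
  let ?J = "Idl\<^bsub>sym_free I\<^esub> (sym_relations I)"
  interpret H: ring_hom_ring "sym_free I" "rees_algebra I" to_rees
    by (rule ring_hom_to_rees[OF I])
  interpret J: ideal ?J "sym_free I" by (rule ideal_sym_relations[OF I])
  have Jker: "to_rees p = 0" if "p \<in> ?J" for p
    by (rule sym_relations_kernel[OF I ring_map_const_poly _ _ that]) auto
  have zero: "\<zero>\<^bsub>rees_algebra I\<^esub> = 0" by (simp add: rees_algebra_def)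
  have ker: "a_kernel (sym_free I) (rees_algebra I) to_rees = {p\<in>carrier (sym_free I). to_rees p = 0}"
    unfolding a_kernel_def' zero ..
  show ?thesis
  proof
    assume lt: "linear_type I"
    then have inj: "inj_on sym_to_rees (carrier (symmetric_algebra I))"
      by (auto simp: linear_type_def ring_iso_def bij_betw_def)
    show "\<forall>p\<in>carrier (sym_free I). to_rees p = 0 \<longrightarrow> p \<in> ?J"
    proof (intro ballI impI)
      fix p assume p: "p \<in> carrier (sym_free I)" "to_rees p = 0"
      have coset: "to_rees ` (?J +>\<^bsub>sym_free I\<^esub> x) = {to_rees x}"
        if x: "x \<in> carrier (sym_free I)" for x
      proof -
        have "to_rees y = to_rees x" if y: "y \<in> ?J +>\<^bsub>sym_free I\<^esub> x" for y
        proof -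
          from y obtain j where "j \<in> ?J" "y = j \<oplus>\<^bsub>sym_free I\<^esub> x"
            by (auto simp: a_r_coset_def')
          then show ?thesis
            by (simp add: sym_free_def ring_mapD[OF ring_map_to_rees] Jker)
        qed
        moreover have "x \<in> ?J +>\<^bsub>sym_free I\<^esub> x" by (rule J.a_rcos_self[OF x])
        ultimately show ?thesis by blast
      qed
      have mem: "?J +>\<^bsub>sym_free I\<^esub> x \<in> carrier (symmetric_algebra I)"
        if "x \<in> carrier (sym_free I)" for x
        using that unfolding symmetric_algebra_def FactRing_simps by simp blast
      have "sym_to_rees (?J +>\<^bsub>sym_free I\<^esub> p) = sym_to_rees (?J +>\<^bsub>sym_free I\<^esub> 0)"
        unfolding sym_to_rees_def coset[OF p(1)] coset[OF sym_free_closed(2)]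
        using p(2) by (simp add: ring_mapD[OF ring_map_to_rees])
      with inj mem p(1) sym_free_closed(2)
      have eq: "?J +>\<^bsub>sym_free I\<^esub> p = ?J +>\<^bsub>sym_free I\<^esub> 0"
        by (meson inj_onD)
      have "p \<in> ?J +>\<^bsub>sym_free I\<^esub> 0"
        unfolding eq[symmetric] by (rule J.a_rcos_self[OF p(1)])
      then obtain j where "j \<in> ?J" "p = j \<oplus>\<^bsub>sym_free I\<^esub> 0"
        unfolding a_r_coset_def' by blast
      then show "p \<in> ?J" by (simp add: sym_free_def)
    qed
  next
    assume *: "\<forall>p\<in>carrier (sym_free I). to_rees p = 0 \<longrightarrow> p \<in> ?J"
    have J: "?J = a_kernel (sym_free I) (rees_algebra I) to_rees"
      unfolding ker using * Jker J.Icarr by blast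
    have img: "to_rees ` carrier (sym_free I) = carrier (rees_algebra I)"
      by (rule image_to_rees[OF I])
    show "linear_type I"
      using H.FactRing_iso_set_aux
      unfolding img linear_type_def symmetric_algebra_def J[symmetric] sym_to_rees_def[abs_def]
      by simp
  qed
qed

section \<open>Quadratic monomials with invertible log-matrix\<close>

abbreviation unit_vec :: "'i \<Rightarrow> 'i monomial"
  where "unit_vec i \<equiv> single i 1"

lemma mdeg_UNIV: "mdeg (m :: 'n::finite monomial) = (\<Sum>i\<in>UNIV. lookup m i)"
  unfolding mdeg_def by (rule sum.mono_neutral_left) (auto simp: in_keys_iff)

lemma mdeg_add: "mdeg ((m :: 'n::finite monomial) + m') = mdeg m + mdeg m'"
  by (simp add: mdeg_UNIV lookup_add sum.distrib)

lemma mdeg_single [simp]: "mdeg (single i k) = k"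
  by (simp add: mdeg_def)

lemma mdeg_zero [simp]: "mdeg 0 = 0"
  by (simp add: mdeg_def)

lemma mdeg_eq_0_iff [simp]: "mdeg (m :: 'n::finite monomial) = 0 \<longleftrightarrow> m = 0"
  by (auto simp: mdeg_UNIV intro!: poly_mapping_eqI)

lemma unit_vec_dvd:
  assumes "lookup m i > 0"
  obtains m' where "m = unit_vec i + m'"
proof
  show "m = unit_vec i + (m - unit_vec i)"
    by (rule poly_mapping_eqI) (use assms in \<open>auto simp: lookup_add lookup_minus lookup_single when_def\<close>)
qed

lemma keys_edge: "keys (unit_vec x + unit_vec y :: 'i monomial) = {x, y}"
  by (auto simp: in_keys_iff lookup_add lookup_single when_def split: if_splits)

lemma mdeg_2_split:
  fixes m :: "'n::finite monomial"
  assumes "mdeg m = 2" "x \<in> keys m"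
  obtains y where "m = unit_vec x + unit_vec y"
proof -
  from assms(2) have "lookup m x > 0" by (simp add: in_keys_iff)
  then obtain m' where m': "m = unit_vec x + m'" by (rule unit_vec_dvd)
  with assms(1) have deg: "mdeg m' = 1" by (simp add: mdeg_add)
  then obtain y where "lookup m' y > 0"
    by (metis gr0I mdeg_eq_0_iff poly_mapping_eqI lookup_zero zero_neq_one)
  then obtain m'' where "m' = unit_vec y + m''" by (rule unit_vec_dvd)
  with deg m' that show ?thesis by (simp add: mdeg_add)
qed

text \<open>The equation is \<open>A B = [\<gamma>|...|\<gamma>] + I\<close>, where \<open>A\<close> and \<open>B\<close> have the columns \<open>F j\<close> and \<open>G j\<close>. The
  type \<open>'n\<close> numbers both the variables, which are the vertices of the graph, and the monomials \<open>F j\<close>,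
  which are its edges. So a multiset of edges is an \<open>'n monomial\<close>, as is a multiset of vertices.\<close>

locale cremona_quadrics =
  fixes F G :: "'n::finite \<Rightarrow> 'n monomial" and \<gamma> :: "'n \<Rightarrow> nat"
  assumes inj_F: "inj F" and deg_F: "mdeg (F j) = 2"
    and inverse: "(\<Sum>j\<in>UNIV. lookup (F j) i * lookup (G v) j) = \<gamma> i + (if i = v then 1 else 0)"
begin

text \<open>The vector \<open>A u\<close>: the number of ends at \<open>i\<close> of the multiset of edges \<open>u\<close>.\<close>

definition vdeg :: "'n monomial \<Rightarrow> 'n \<Rightarrow> nat"
  where "vdeg u i = (\<Sum>j\<in>UNIV. lookup u j * lookup (F j) i)"

lemma vdeg_add: "vdeg (u + v) i = vdeg u i + vdeg v i"
  by (simp add: vdeg_def lookup_add algebra_simps sum.distrib)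

lemma vdeg_zero [simp]: "vdeg 0 i = 0"
  by (simp add: vdeg_def)

lemma vdeg_single [simp]: "vdeg (single j k) i = k * lookup (F j) i"
  by (simp add: vdeg_def lookup_single when_def if_distrib[of "\<lambda>x. x * y" for y] cong: if_cong)

lemma vdeg_G: "vdeg (G v) i = \<gamma> i + lookup (unit_vec v) i"
  using inverse[of i v] by (simp add: vdeg_def mult.commute lookup_single when_def)

lemma sum_vdeg: "(\<Sum>i\<in>UNIV. vdeg u i) = 2 * mdeg u"
proof -
  have "(\<Sum>i\<in>UNIV. vdeg u i) = (\<Sum>j\<in>UNIV. lookup u j * mdeg (F j))"
    unfolding vdeg_def mdeg_UNIV sum_distrib_left by (rule sum.swap)
  then show ?thesis by (simp add: deg_F mdeg_UNIV[of u] sum_distrib_left mult.commute)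
qed

lemma vdeg_pos:
  assumes "vdeg u i > 0"
  obtains j where "lookup u j > 0" "i \<in> keys (F j)"
proof -
  from assms have "\<exists>j. lookup u j * lookup (F j) i \<noteq> 0"
    unfolding vdeg_def by (metis (no_types, lifting) less_numeral_extra(3) sum.neutral)
  then show thesis using that by (auto simp: in_keys_iff)
qed

lemma vdeg_ge: "lookup u j * lookup (F j) i \<le> vdeg u i"
  unfolding vdeg_def by (rule member_le_sum) auto

text \<open>If \<open>y A = 0\<close> for a row vector \<open>y\<close>, then \<open>0 = y A B = (y \<cdot> \<gamma>) (1, ..., 1) + y\<close>, so all entries of
  \<open>y\<close> are equal; as the columns of \<open>A\<close> have sum 2, \<open>y = 0\<close>. A square matrix with trivial left kernel
  is invertible.\<close>

lemma log_matrix_kernel: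
  fixes z :: "'n \<Rightarrow> real"
  assumes z: "\<And>i. (\<Sum>j\<in>UNIV. real (lookup (F j) i) * z j) = 0"
  shows "z j = 0"
proof -
  define A :: "real ^ 'n ^ 'n" where "A = (\<chi> i j. real (lookup (F j) i))"
  have "x = 0" if "transpose A *v x = 0" for x
  proof -
    have x: "(\<Sum>i\<in>UNIV. real (lookup (F j) i) * x $ i) = 0" for j
      using that by (auto simp: vec_eq_iff A_def matrix_vector_mult_def transpose_def)
    define S where "S = (\<Sum>i\<in>UNIV. real (\<gamma> i) * x $ i)"
    have "x $ v = - S" for v
    proof -
      have "0 = (\<Sum>j\<in>UNIV. real (lookup (G v) j) * (\<Sum>i\<in>UNIV. real (lookup (F j) i) * x $ i))"
        by (simp add: x)
      also have "\<dots> = (\<Sum>i\<in>UNIV. \<Sum>j\<in>UNIV. real (lookup (F j) i * lookup (G v) j) * x $ i)"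
        unfolding sum_distrib_left by (subst sum.swap) (simp add: algebra_simps)
      also have "\<dots> = (\<Sum>i\<in>UNIV. (real (\<gamma> i) + (if i = v then 1 else 0)) * x $ i)"
        unfolding sum_distrib_right[symmetric] of_nat_sum[symmetric] inverse
        by (intro sum.cong) auto
      also have "\<dots> = S + x $ v"
        by (simp add: S_def algebra_simps sum.distrib mult_delta_right)
      finally show ?thesis by simp
    qed
    then have "0 = (\<Sum>i\<in>UNIV. real (lookup (F j) i)) * (- S)" for j
      using x[of j] by (simp add: sum_distrib_right[symmetric] sum_negf)
    moreover have "(\<Sum>i\<in>UNIV. real (lookup (F j) i)) = 2" for j
      using deg_F[of j] by (simp add: mdeg_UNIV flip: of_nat_sum)
    ultimately have "S = 0" by simp
    with \<open>\<And>v. x $ v = - S\<close> show ?thesis by (simp add: vec_eq_iff)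
  qed
  then obtain B where "B ** transpose A = mat 1"
    using matrix_left_invertible_ker by blast
  then have "A ** transpose B = mat 1"
    by (metis matrix_transpose_mul transpose_mat transpose_transpose)
  then have "transpose B ** A = mat 1" by (simp add: matrix_left_right_inverse)
  moreover have "A *v (\<chi> j. z j) = 0"
    using z by (simp add: vec_eq_iff A_def matrix_vector_mult_def)
  ultimately have "(\<chi> j. z j) = 0" using matrix_left_invertible_ker by blast
  then show ?thesis by (simp add: vec_eq_iff)
qed

lemma vdeg_inject:
  assumes "\<And>i. vdeg u i = vdeg v i"
  shows "u = v"
proof (rule poly_mapping_eqI)
  fix j
  have "real (lookup u j) - real (lookup v j) = 0"
  proof (rule log_matrix_kernel)
    fix i
    have "real (vdeg u i) = real (vdeg v i)" using assms by simp
    then show "(\<Sum>j\<in>UNIV. real (lookup (F j) i) * (real (lookup u j) - real (lookup v j))) = 0"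
      by (simp add: vdeg_def algebra_simps sum_subtractf)
  qed
  then show "lookup u j = lookup v j" by simp
qed

lemma edge_split:
  assumes "x \<in> keys (F j)"
  obtains y where "F j = unit_vec x + unit_vec y"
  using mdeg_2_split[OF deg_F assms] by blast

lemma edge_eq:
  assumes "x \<in> keys (F j)" "y \<in> keys (F j)" "x \<noteq> y"
  shows "F j = unit_vec x + unit_vec y"
proof -
  obtain z where z: "F j = unit_vec x + unit_vec z" using assms(1) by (rule edge_split)
  with assms have "y = z" unfolding z keys_edge by auto
  with z show ?thesis by simp
qed

lemma keys_F_nonempty: "keys (F j) \<noteq> {}"
  using deg_F[of j] by auto

definition linked :: bool
  where "linked \<longleftrightarrow> (\<forall>e f. keys (F e) \<inter> keys (F f) = {} \<longrightarrow>
    (\<exists>g. keys (F g) \<inter> keys (F e) \<noteq> {} \<and> keys (F g) \<inter> keys (F f) \<noteq> {}))"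

text \<open>Pairs of a multiset of edges and a multiset of vertices with the same total multiset of vertices
  are connected by exchanges of one vertex. By the injectivity of \<open>A\<close> there is a vertex \<open>i\<close> that is more
  frequent in \<open>\<alpha>\<close> than in \<open>\<beta>\<close>, unless there is a common edge; then \<open>v\<close> has an edge \<open>f = ik\<close>. If \<open>u\<close>
  has an edge \<open>kl\<close>, the exchange of \<open>kl\<close>, \<open>i\<close> for \<open>ik\<close>, \<open>l\<close> brings \<open>f\<close> into \<open>u\<close>. Otherwise both ends
  of \<open>f\<close> are in \<open>\<alpha>\<close>, and any edge of \<open>u\<close> can be traded for \<open>f\<close>; only this step uses that the graph is
  linked.\<close>

lemma relations_connected:
  fixes Rel :: "'n monomial \<Rightarrow> 'n monomial \<Rightarrow> 'n monomial \<Rightarrow> 'n monomial \<Rightarrow> bool"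
  assumes linked
    and refl: "\<And>u \<alpha>. Rel u \<alpha> u \<alpha>"
    and trans: "\<And>u \<alpha> v \<beta> w \<delta>. Rel u \<alpha> v \<beta> \<Longrightarrow> Rel v \<beta> w \<delta> \<Longrightarrow> Rel u \<alpha> w \<delta>"
    and add: "\<And>u \<alpha> v \<beta> w \<delta>. Rel u \<alpha> v \<beta> \<Longrightarrow> Rel (w + u) (\<delta> + \<alpha>) (w + v) (\<delta> + \<beta>)"
    and move: "\<And>e f b c. F e + unit_vec c = F f + unit_vec b \<Longrightarrow>
      Rel (unit_vec e) (unit_vec c) (unit_vec f) (unit_vec b)"
    and bal: "\<And>i. vdeg u i + lookup \<alpha> i = vdeg v i + lookup \<beta> i" and deg: "mdeg u = mdeg v"
  shows "Rel u \<alpha> v \<beta>"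
proof -
  \<comment> \<open>Through a common vertex this is one exchange, through a linking edge it takes two.\<close>
  have swap: "Rel (unit_vec e) (F f) (unit_vec f) (F e)" for e f
  proof (cases "keys (F e) \<inter> keys (F f) = {}")
    case False
    then obtain p where p: "p \<in> keys (F e)" "p \<in> keys (F f)" by auto
    obtain a b where e: "F e = unit_vec p + unit_vec a" and f: "F f = unit_vec p + unit_vec b"
      using p by (metis edge_split)
    have "Rel (unit_vec e) (unit_vec b) (unit_vec f) (unit_vec a)"
      by (rule move) (simp add: e f algebra_simps)
    from add[OF this, of 0 "unit_vec p"] show ?thesis by (simp add: e f)
  next
    case True
    with \<open>linked\<close> obtain g p q where g: "p \<in> keys (F g)" "q \<in> keys (F g)"
      and pq: "p \<in> keys (F e)" "q \<in> keys (F f)" unfolding linked_def by blast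
    obtain a b where e: "F e = unit_vec p + unit_vec a" and f: "F f = unit_vec q + unit_vec b"
      using pq by (metis edge_split)
    from True pq have "p \<noteq> q" by auto
    with g have g: "F g = unit_vec p + unit_vec q" by (rule edge_eq)
    have "Rel (unit_vec e) (unit_vec q) (unit_vec g) (unit_vec a)"
      by (rule move) (simp add: e g algebra_simps)
    from add[OF this, of 0 "unit_vec b"]
    have 1: "Rel (unit_vec e) (F f) (unit_vec g) (unit_vec a + unit_vec b)"
      by (simp add: f algebra_simps)
    have "Rel (unit_vec g) (unit_vec b) (unit_vec f) (unit_vec p)"
      by (rule move) (simp add: f g algebra_simps)
    from add[OF this, of 0 "unit_vec a"]
    have 2: "Rel (unit_vec g) (unit_vec a + unit_vec b) (unit_vec f) (F e)"
      by (simp add: e algebra_simps)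
    from trans[OF 1 2] show ?thesis .
  qed
  show ?thesis
    using bal deg
  proof (induction "mdeg u" arbitrary: u \<alpha> v \<beta>)
    case 0
    then have "u = 0" "v = 0" by (metis mdeg_eq_0_iff)+
    moreover from this 0 have "\<alpha> = \<beta>" by (intro poly_mapping_eqI) simp
    ultimately show ?case by (simp add: refl)
  next
    case (Suc n)
    \<comment> \<open>An edge common to both sides is cancelled, which shortens \<open>u\<close>; every exchange below only
      serves to create one.\<close>
    have cancel: "Rel u' \<alpha>' v \<beta>"
      if u': "lookup u' f > 0" "lookup v f > 0" "mdeg u' = Suc n"
        and bal: "\<And>i. vdeg u' i + lookup \<alpha>' i = vdeg v i + lookup \<beta> i" for u' \<alpha>' f
    proof -
      obtain u'' v'' where 1: "u' = unit_vec f + u''" "v = unit_vec f + v''"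
        using u' by (metis unit_vec_dvd)
      have "Rel u'' \<alpha>' v'' \<beta>"
        by (rule Suc.hyps(1)) (use bal u' Suc in \<open>auto simp: 1 vdeg_add mdeg_add\<close>)
      from add[OF this, of "unit_vec f" 0] show ?thesis by (simp add: 1)
    qed
    show ?case
    proof (cases "\<exists>f. lookup u f > 0 \<and> lookup v f > 0")
      case True
      then show ?thesis using cancel Suc by metis
    next
      case False
      have "\<exists>i. lookup \<alpha> i > lookup \<beta> i"
      proof (rule ccontr)
        assume "\<not> ?thesis"
        then have le: "lookup \<alpha> i \<le> lookup \<beta> i" for i by (simp add: not_less)
        have "(\<Sum>i\<in>UNIV. vdeg u i + lookup \<alpha> i) = (\<Sum>i\<in>UNIV. vdeg v i + lookup \<beta> i)"
          using Suc.prems(1) by simp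
        then have "(\<Sum>i\<in>UNIV. lookup \<alpha> i) = (\<Sum>i\<in>UNIV. lookup \<beta> i)"
          by (simp add: sum.distrib sum_vdeg Suc.prems(2))
        with le have "lookup \<alpha> i = lookup \<beta> i" for i
          by (metis finite_class.finite_UNIV iso_tuple_UNIV_I sum_mono_inv)
        then have "u = v" using Suc.prems(1) by (intro vdeg_inject) simp
        moreover from Suc.hyps(2) have "u \<noteq> 0" by auto
        then obtain f where "lookup u f > 0" by (metis gr0I poly_mapping_eqI lookup_zero)
        ultimately show False using False by auto
      qed
      then obtain i where i: "lookup \<alpha> i > lookup \<beta> i" by auto
      with Suc.prems(1)[of i] have "vdeg v i > 0" by simp
      then obtain f where f: "lookup v f > 0" "i \<in> keys (F f)" by (rule vdeg_pos)
      then obtain k where F_f: "F f = unit_vec i + unit_vec k" using edge_split by metis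
      show ?thesis
      proof (cases "vdeg u k > 0")
        case True
        then obtain e where e: "lookup u e > 0" "k \<in> keys (F e)" by (rule vdeg_pos)
        then obtain l where F_e: "F e = unit_vec k + unit_vec l" using edge_split by metis
        obtain u' where u': "u = unit_vec e + u'" using e by (metis unit_vec_dvd)
        obtain \<alpha>' where \<alpha>': "\<alpha> = unit_vec i + \<alpha>'" using i by (metis unit_vec_dvd gr_implies_not0 gr0I)
        have "Rel (unit_vec e) (unit_vec i) (unit_vec f) (unit_vec l)"
          by (rule move) (simp add: F_f F_e algebra_simps)
        from add[OF this, of u' \<alpha>'] have "Rel u \<alpha> (unit_vec f + u') (unit_vec l + \<alpha>')"
          by (simp add: u' \<alpha>' algebra_simps)
        moreover have "Rel (unit_vec f + u') (unit_vec l + \<alpha>') v \<beta>"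
        proof (rule cancel)
          show "vdeg (unit_vec f + u') x + lookup (unit_vec l + \<alpha>') x = vdeg v x + lookup \<beta> x" for x
            using Suc.prems(1)[of x] by (simp add: u' \<alpha>' vdeg_add lookup_add F_e F_f)
        qed (use f Suc.hyps(2) in \<open>auto simp: u' lookup_add mdeg_add\<close>)
        ultimately show ?thesis by (rule trans)
      next
        case F: False
        \<comment> \<open>The balance at \<open>k\<close> puts \<open>k\<close> into \<open>\<alpha>\<close>, like \<open>i\<close>; if \<open>f\<close> is a loop, with
          multiplicity two.\<close>
        have "lookup \<alpha> x \<ge> lookup (F f) x" for x
        proof (cases "x = i \<or> x = k")
          case True
          have "vdeg v x \<ge> lookup (F f) x" using vdeg_ge[of v f x] f(1)
            by (metis Suc_leI dual_order.trans mult_le_mono1 mult_1 One_nat_def)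
          moreover have "vdeg v k > 0" using vdeg_ge[of v f k] f(1)
            by (auto simp: F_f lookup_add)
          ultimately show ?thesis
            using True Suc.prems(1)[of x] Suc.prems(1)[of k] F i
            by (cases "i = k") (auto simp: F_f lookup_add lookup_single when_def)
        qed (auto simp: F_f lookup_add lookup_single when_def)
        then have "\<alpha> = F f + (\<alpha> - F f)"
          by (intro poly_mapping_eqI) (simp add: lookup_add lookup_minus)
        then obtain \<alpha>' where \<alpha>': "\<alpha> = F f + \<alpha>'" by blast
        from Suc.hyps(2) have "u \<noteq> 0" by auto
        then obtain e where "lookup u e > 0" by (metis gr0I poly_mapping_eqI lookup_zero)
        then obtain u' where u': "u = unit_vec e + u'" by (metis unit_vec_dvd)
        from add[OF swap[of e f], of u' \<alpha>']
        have "Rel u \<alpha> (unit_vec f + u') (F e + \<alpha>')"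
          by (simp add: u' \<alpha>' algebra_simps)
        moreover have "Rel (unit_vec f + u') (F e + \<alpha>') v \<beta>"
        proof (rule cancel)
          show "vdeg (unit_vec f + u') x + lookup (F e + \<alpha>') x = vdeg v x + lookup \<beta> x" for x
            using Suc.prems(1)[of x] by (simp add: u' \<alpha>' vdeg_add lookup_add)
        qed (use f Suc.hyps(2) in \<open>auto simp: u' lookup_add mdeg_add\<close>)
        ultimately show ?thesis by (rule trans)
      qed
    qed
  qed
qed

end

section \<open>Linear type of the inverse ideal\<close>

lemma ring_map_monval:
  fixes \<sigma> :: "'i \<Rightarrow> 'a::comm_ring_1"
  assumes "ring_map c"
  shows "c (monval \<sigma> m) = monval (\<lambda>i. c (\<sigma> i)) m"
proof -
  have pow: "c (x ^ k) = c x ^ k" for x k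
    by (induction k) (simp_all add: ring_mapD[OF assms])
  have "c (\<Prod>i\<in>M. f i) = (\<Prod>i\<in>M. c (f i))" for M and f :: "'i \<Rightarrow> 'a"
    by (induction M rule: infinite_finite_induct) (simp_all add: ring_mapD[OF assms])
  then show ?thesis by (simp add: monval_def pow)
qed

lemma monval_linear_poly:
  "monval (\<lambda>i. [:0, g i:]) (m :: 'n::finite monomial) = Polynomial.monom (monval g m) (mdeg m)"
proof (induction m rule: poly_mapping_single_induct)
  case (single i k)
  have "[:0, g i:] ^ k = Polynomial.monom (g i ^ k) k"
    by (induction k) (simp_all add: monom_0 monom_Suc one_pCons smult_monom mult.commute)
  then show ?case by simp
qed (simp_all add: monval_add mult_monom mdeg_add monom_0 one_pCons)

context cremona_quadrics
begin

text \<open>The vector \<open>B \<alpha>\<close>, which is the exponent of the product of the generators \<open>x^(G v)\<close> with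
  multiplicities \<open>\<alpha>\<close>.\<close>

definition comb :: "'n monomial \<Rightarrow> 'n monomial"
  where "comb \<alpha> = Abs_poly_mapping (\<lambda>j. \<Sum>v\<in>UNIV. lookup \<alpha> v * lookup (G v) j)"

lemma lookup_comb: "lookup (comb \<alpha>) j = (\<Sum>v\<in>UNIV. lookup \<alpha> v * lookup (G v) j)"
  unfolding comb_def by (subst lookup_Abs_poly_mapping) auto

lemma comb_zero [simp]: "comb 0 = 0"
  by (rule poly_mapping_eqI) (simp add: lookup_comb)

lemma comb_add: "comb (\<alpha> + \<beta>) = comb \<alpha> + comb \<beta>"
  by (rule poly_mapping_eqI) (simp add: lookup_comb lookup_add algebra_simps sum.distrib)

lemma comb_unit_vec [simp]: "comb (single v (Suc 0)) = G v"
  by (rule poly_mapping_eqI) (simp add: lookup_comb lookup_single when_def mult_delta_left)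

lemma vdeg_comb: "vdeg (comb \<alpha>) i = mdeg \<alpha> * \<gamma> i + lookup \<alpha> i"
proof -
  have "vdeg (comb \<alpha>) i = (\<Sum>v\<in>UNIV. lookup \<alpha> v * (\<Sum>j\<in>UNIV. lookup (F j) i * lookup (G v) j))"
    unfolding vdeg_def lookup_comb sum_distrib_right sum_distrib_left
    by (subst sum.swap) (simp add: algebra_simps)
  then show ?thesis
    by (simp add: inverse mdeg_UNIV distrib_left sum.distrib sum_distrib_right mult_delta_right)
qed

text \<open>Multiplication by the injective matrix \<open>A\<close> turns \<open>u + B \<alpha>\<close> into \<open>A u + |\<alpha>| \<gamma> + \<alpha>\<close>.\<close>

lemma exponent_eq_iff:
  assumes "mdeg \<alpha> = mdeg \<beta>"
  shows "u + comb \<alpha> = v + comb \<beta> \<longleftrightarrow> (\<forall>i. vdeg u i + lookup \<alpha> i = vdeg v i + lookup \<beta> i)"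
proof
  assume "u + comb \<alpha> = v + comb \<beta>"
  then have "vdeg (u + comb \<alpha>) i = vdeg (v + comb \<beta>) i" for i by simp
  then show "\<forall>i. vdeg u i + lookup \<alpha> i = vdeg v i + lookup \<beta> i"
    by (simp add: vdeg_add vdeg_comb assms)
qed (auto intro!: vdeg_inject simp: vdeg_add vdeg_comb assms)

abbreviation inv_gen :: "'n \<Rightarrow> ('n, 'k::field) mpoly"
  where "inv_gen j \<equiv> mono_poly (G j)"

abbreviation inv_ideal :: "('n, 'k::field) mpoly set"
  where "inv_ideal \<equiv> ideal_of (range inv_gen)"

abbreviation (input) relation_ideal :: "(('n, 'k::field) mpoly, ('n, 'k) mpoly) mpoly set"
  where "relation_ideal \<equiv> Idl\<^bsub>sym_free inv_ideal\<^esub> (sym_relations inv_ideal)"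

text \<open>The monomial \<open>x^u T^\<alpha>\<close>, where \<open>T_v\<close> is the symbol of the generator \<open>x^(G v)\<close>.\<close>

definition rees_monomial :: "'n monomial \<Rightarrow> 'n monomial \<Rightarrow> (('n, 'k::field) mpoly, ('n, 'k) mpoly) mpoly"
  where "rees_monomial u \<alpha> = mconst (mono_poly u) * monval (\<lambda>v. mvar (inv_gen v)) \<alpha>"

lemma monval_inv_gen: "monval inv_gen \<alpha> = (mono_poly (comb \<alpha>) :: ('n, 'k::field) mpoly)"
proof (induction \<alpha> rule: poly_mapping_single_induct)
  case (single v k)
  have "inv_gen v ^ k = (mono_poly (comb (single v k)) :: ('n, 'k) mpoly)"
  proof (induction k)
    case 0
    then show ?case by (simp add: mono_poly_def)
  next
    case (Suc k)
    have "single v (Suc k) = unit_vec v + single v k" by (simp add: single_add[symmetric])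
    then show ?case using Suc by (simp add: comb_add mono_poly_add)
  qed
  then show ?case by simp
qed (simp_all add: monval_add comb_add mono_poly_add, simp add: mono_poly_def)

lemma rees_monomial_add:
  "rees_monomial (u + v) (\<alpha> + \<beta>) = rees_monomial u \<alpha> * rees_monomial v \<beta>"
  by (simp add: rees_monomial_def mono_poly_add monval_add ring_mapD[OF ring_map_mconst] algebra_simps)

lemma inv_gen_mem: "inv_gen v \<in> inv_ideal"
  unfolding mem_ideal_of_range_iff by (rule exI[of _ "\<lambda>j. if j = v then 1 else 0"]) (simp add: mult_delta_left)

lemma rees_monomial_mem: "rees_monomial u \<alpha> \<in> carrier (sym_free inv_ideal)"
  unfolding rees_monomial_def
  by (intro sym_free_closed monval_mem_sym_free inv_gen_mem)

lemma to_rees_rees_monomial: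
  "to_rees (rees_monomial u \<alpha>) = Polynomial.monom (mono_poly (u + comb \<alpha>)) (mdeg \<alpha>)"
  by (simp add: rees_monomial_def ring_mapD[OF ring_map_to_rees] ring_map_monval[OF ring_map_to_rees]
      monval_linear_poly monval_inv_gen smult_monom mono_poly_add)

lemma relation_idealD:
  shows "(0 :: (('n, 'k::field) mpoly, ('n, 'k) mpoly) mpoly) \<in> relation_ideal"
    "\<And>x y :: (('n, 'k) mpoly, ('n, 'k) mpoly) mpoly. x \<in> relation_ideal \<Longrightarrow> y \<in> relation_ideal \<Longrightarrow> x + y \<in> relation_ideal"
    "\<And>a x :: (('n, 'k) mpoly, ('n, 'k) mpoly) mpoly. a \<in> carrier (sym_free inv_ideal) \<Longrightarrow> x \<in> relation_ideal \<Longrightarrow> a * x \<in> relation_ideal"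
    "\<And>x :: (('n, 'k) mpoly, ('n, 'k) mpoly) mpoly. x \<in> relation_ideal \<Longrightarrow> - x \<in> relation_ideal"
    "\<And>x y :: (('n, 'k) mpoly, ('n, 'k) mpoly) mpoly. x \<in> relation_ideal \<Longrightarrow> y \<in> relation_ideal \<Longrightarrow> x - y \<in> relation_ideal"
    "\<And>x y z :: (('n, 'k) mpoly, ('n, 'k) mpoly) mpoly. x - y \<in> relation_ideal \<Longrightarrow> y - z \<in> relation_ideal \<Longrightarrow> x - z \<in> relation_ideal"
proof -
  have "ideal (relation_ideal :: (('n, 'k) mpoly, ('n, 'k) mpoly) mpoly set) (ring_on (carrier (sym_free inv_ideal)))"
    using ideal_sym_relations[OF ideal_ideal_of] by (simp add: sym_free_eq[symmetric])
  note D = ideal_ring_onD[OF this]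
  show "(0 :: (('n, 'k::field) mpoly, ('n, 'k) mpoly) mpoly) \<in> relation_ideal" by (rule D(2))
  show add: "\<And>x y :: (('n, 'k) mpoly, ('n, 'k) mpoly) mpoly. x \<in> relation_ideal \<Longrightarrow> y \<in> relation_ideal \<Longrightarrow> x + y \<in> relation_ideal"
    by (rule D(3))
  show "\<And>a x :: (('n, 'k) mpoly, ('n, 'k) mpoly) mpoly. a \<in> carrier (sym_free inv_ideal) \<Longrightarrow> x \<in> relation_ideal \<Longrightarrow> a * x \<in> relation_ideal"
    by (rule D(4))
  show "\<And>x :: (('n, 'k) mpoly, ('n, 'k) mpoly) mpoly. x \<in> relation_ideal \<Longrightarrow> - x \<in> relation_ideal"
    by (rule D(5))
  show "\<And>x y :: (('n, 'k) mpoly, ('n, 'k) mpoly) mpoly. x \<in> relation_ideal \<Longrightarrow> y \<in> relation_ideal \<Longrightarrow> x - y \<in> relation_ideal"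
    by (rule D(6))
  show "x - z \<in> relation_ideal" if "x - y \<in> relation_ideal" "y - z \<in> relation_ideal"
    for x y z :: "(('n, 'k) mpoly, ('n, 'k) mpoly) mpoly"
    using add[OF that] by simp
qed

lemma relation_ideal_add:
  fixes f g :: "('n, 'k::field) mpoly"
  assumes "f \<in> inv_ideal" "g \<in> inv_ideal"
  shows "mvar (f + g) - mvar f - mvar g \<in> relation_ideal"
  by (rule subsetD[OF ring.genideal_self[OF cring.axioms(1)[OF cring_sym_free]
        sym_relations_subset[OF ideal_ideal_of]]])
     (use assms in \<open>unfold sym_relations_def, blast\<close>)

lemma relation_ideal_scale:
  fixes f a :: "('n, 'k::field) mpoly"
  assumes "f \<in> inv_ideal"
  shows "mvar (a * f) - mconst a * mvar f \<in> relation_ideal"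
  by (rule subsetD[OF ring.genideal_self[OF cring.axioms(1)[OF cring_sym_free]
        sym_relations_subset[OF ideal_ideal_of]]])
     (use assms in \<open>unfold sym_relations_def, blast\<close>)

text \<open>An exchange \<open>x_e T_c = x_f T_b\<close> follows from the relations because \<open>x_e x^(G c) = x_f x^(G b)\<close>;
  both sides are congruent to the symbol of this element of the ideal.\<close>

lemma rees_monomial_cong:
  assumes linked and exp: "u + comb \<alpha> = v + comb \<beta>" and deg: "mdeg \<alpha> = mdeg \<beta>"
  shows "rees_monomial u \<alpha> - (rees_monomial v \<beta> :: (('n, 'k::field) mpoly, ('n, 'k) mpoly) mpoly) \<in> relation_ideal"
proof (rule relations_connected[where Rel = "\<lambda>u \<alpha> v \<beta>. rees_monomial u \<alpha> -
        (rees_monomial v \<beta> :: (('n, 'k) mpoly, ('n, 'k) mpoly) mpoly) \<in> relation_ideal"])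
  show bal: "vdeg u i + lookup \<alpha> i = vdeg v i + lookup \<beta> i" for i
    using exp exponent_eq_iff[OF deg] by simp
  have "(\<Sum>i\<in>UNIV. vdeg u i + lookup \<alpha> i) = (\<Sum>i\<in>UNIV. vdeg v i + lookup \<beta> i)"
    by (simp add: bal)
  then show "mdeg u = mdeg v"
    using deg by (simp add: sum.distrib sum_vdeg mdeg_UNIV[of \<alpha>] mdeg_UNIV[of \<beta>])
next
  fix e f b c assume move: "F e + unit_vec c = F f + unit_vec b"
  have "unit_vec e + comb (unit_vec c) = unit_vec f + comb (unit_vec b)"
    using arg_cong[OF move, of lookup]
    by (subst exponent_eq_iff) (auto simp: fun_eq_iff lookup_add)
  then have eq: "mono_poly (unit_vec e) * inv_gen c = (mono_poly (unit_vec f) * inv_gen b :: ('n, 'k) mpoly)"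
    by (simp add: mono_poly_add[symmetric])
  have "(mvar (mono_poly (unit_vec f) * inv_gen b) - rees_monomial (unit_vec f) (unit_vec b)
       :: (('n, 'k) mpoly, ('n, 'k) mpoly) mpoly) \<in> relation_ideal"
    using relation_ideal_scale[OF inv_gen_mem[of b], of "mono_poly (unit_vec f)"]
    by (simp add: rees_monomial_def)
  moreover have "(mvar (mono_poly (unit_vec e) * inv_gen c) - rees_monomial (unit_vec e) (unit_vec c)
       :: (('n, 'k) mpoly, ('n, 'k) mpoly) mpoly) \<in> relation_ideal"
    using relation_ideal_scale[OF inv_gen_mem[of c], of "mono_poly (unit_vec e)"]
    by (simp add: rees_monomial_def)
  ultimately show "rees_monomial (unit_vec e) (unit_vec c) -
      (rees_monomial (unit_vec f) (unit_vec b) :: (('n, 'k) mpoly, ('n, 'k) mpoly) mpoly) \<in> relation_ideal"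
    unfolding eq using relation_idealD(5) by fastforce
next
  fix u \<alpha> v \<beta> w \<delta>
  assume "rees_monomial u \<alpha> - (rees_monomial v \<beta> :: (('n, 'k) mpoly, ('n, 'k) mpoly) mpoly) \<in> relation_ideal"
  from relation_idealD(3)[OF rees_monomial_mem[of w \<delta>] this]
  show "rees_monomial (w + u) (\<delta> + \<alpha>) - (rees_monomial (w + v) (\<delta> + \<beta>) :: (('n, 'k) mpoly, ('n, 'k) mpoly) mpoly) \<in> relation_ideal"
    by (simp add: rees_monomial_add right_diff_distrib)
qed (use \<open>linked\<close> relation_idealD(1,6) in \<open>auto\<close>)

abbreviation inv_subst :: "('n, ('n, 'k::field) mpoly) mpoly \<Rightarrow> (('n, 'k) mpoly, ('n, 'k) mpoly) mpoly"
  where "inv_subst \<equiv> meval mconst (\<lambda>v. mvar (inv_gen v))"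

text \<open>If \<open>h = (\<Sum>j. a j * x^(G j))\<close>, then the symbol of \<open>h\<close> is congruent to \<open>\<Sum>j. a j * T_j\<close>.\<close>

lemma inv_subst_surj:
  fixes p :: "(('n, 'k::field) mpoly, ('n, 'k) mpoly) mpoly"
  assumes "p \<in> carrier (sym_free inv_ideal)"
  obtains q where "p - inv_subst q \<in> relation_ideal"
proof -
  note hom = ring_mapD[OF ring_map_meval[OF ring_map_mconst]]
  have "\<exists>q. p - inv_subst q \<in> relation_ideal"
    using assms
  proof (induction p rule: sym_free_induct)
    case (const a)
    show ?case by (rule exI[of _ "mconst a"]) (simp add: meval_mconst[OF ring_map_mconst] relation_idealD(1))
  next
    case (var f)
    then obtain a where f: "f = (\<Sum>j\<in>UNIV. a j * inv_gen j)" unfolding mem_ideal_of_range_iff by auto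
    have "(\<Sum>j\<in>M. a j * inv_gen j) \<in> inv_ideal \<and>
      mvar (\<Sum>j\<in>M. a j * inv_gen j) - inv_subst (\<Sum>j\<in>M. mconst (a j) * mvar j) \<in> relation_ideal"
      if "finite M" for M
      using that
    proof (induction M rule: finite_induct)
      case empty
      have 0: "(0 :: ('n, 'k) mpoly) \<in> inv_ideal" by (rule ideal_ring_onD(2)[OF ideal_ideal_of])
      have "mvar 0 \<in> (relation_ideal :: (('n, 'k) mpoly, ('n, 'k) mpoly) mpoly set)"
        using relation_ideal_scale[OF 0, of 0] by (simp add: ring_mapD[OF ring_map_mconst])
      with 0 show ?case by (simp add: hom)
    next
      case (insert j M)
      let ?s = "\<Sum>j\<in>M. a j * inv_gen j"
      have mem: "a j * inv_gen j \<in> inv_ideal"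
        by (rule ideal_ring_onD(4)[OF ideal_ideal_of UNIV_I inv_gen_mem])
      have "mvar (a j * inv_gen j + ?s) - (mconst (a j) * mvar (inv_gen j) + inv_subst (\<Sum>j\<in>M. mconst (a j) * mvar j))
        = (mvar (a j * inv_gen j + ?s) - mvar (a j * inv_gen j) - mvar ?s)
          + (mvar (a j * inv_gen j) - mconst (a j) * mvar (inv_gen j))
          + (mvar ?s - inv_subst (\<Sum>j\<in>M. mconst (a j) * mvar j))"
        by simp
      also have "\<dots> \<in> relation_ideal"
        using relation_ideal_add[OF mem] relation_ideal_scale[OF inv_gen_mem] insert.IH
        by (intro relation_idealD(2)) auto
      finally show ?case
        using insert mem ideal_ring_onD(3)[OF ideal_ideal_of mem]
        by (simp add: hom meval_mconst[OF ring_map_mconst] meval_mvar[OF ring_map_mconst])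
    qed
    from this[of UNIV] show ?case using f by auto
  next
    case (add p1 p2)
    then obtain q1 q2 where "p1 - inv_subst q1 \<in> relation_ideal" "p2 - inv_subst q2 \<in> relation_ideal" by auto
    from relation_idealD(2)[OF this] show ?case
      by (intro exI[of _ "q1 + q2"]) (simp add: hom algebra_simps)
  next
    case (mult p1 p2)
    then obtain q1 q2 where q: "p1 - inv_subst q1 \<in> relation_ideal" "p2 - inv_subst q2 \<in> relation_ideal" by auto
    have "inv_subst q2 \<in> carrier (sym_free inv_ideal)"
    proof (induction q2 rule: poly_mapping_single_induct)
      case (single m a)
      then show ?case unfolding meval_single[OF ring_map_mconst]
        by (intro sym_free_closed monval_mem_sym_free inv_gen_mem)
    qed (auto simp: hom intro: sym_free_closed)
    then have "p1 * (p2 - inv_subst q2) + inv_subst q2 * (p1 - inv_subst q1) \<in> relation_ideal"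
      using q mult by (intro relation_idealD(2,3))
    then show ?case
      by (intro exI[of _ "q1 * q2"]) (simp add: hom algebra_simps)
  qed
  then show thesis using that by auto
qed

text \<open>The map \<open>\<Psi>\<close> sends each term of the Rees algebra to a chosen monomial above it. As all monomials
  above one term are congruent, \<open>\<Psi>\<close> inverts the map to the Rees algebra modulo the relations, and so
  an element with image 0 is a consequence of them.\<close>

theorem linked_imp_linear_type:
  assumes linked
  shows "linear_type (inv_ideal :: ('n, 'k::field) mpoly set)"
  unfolding linear_type_iff[OF ideal_ideal_of]
proof (intro ballI impI)
  fix p :: "(('n, 'k) mpoly, ('n, 'k) mpoly) mpoly"
  assume p: "p \<in> carrier (sym_free inv_ideal)" "to_rees p = 0"
  note hom = ring_mapD[OF ring_map_meval[OF ring_map_mconst]]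
  \<comment> \<open>\<open>norm d w a\<close> is the chosen preimage of \<open>a x^w t^d\<close>.\<close>
  define rep where "rep w d = (SOME (u, \<alpha>). u + comb \<alpha> = w \<and> mdeg \<alpha> = d)" for w d
  define norm :: "nat \<Rightarrow> 'n monomial \<Rightarrow> 'k \<Rightarrow> (('n, 'k) mpoly, ('n, 'k) mpoly) mpoly"
    where "norm d w a = mconst (mconst a) * rees_monomial (fst (rep w d)) (snd (rep w d))" for d w a
  define \<Psi> where "\<Psi> q = (\<Sum>d\<le>Polynomial.degree q. lin_ext (norm d) (poly.coeff q d))" for q
  have norm: "norm d w 0 = 0" "norm d w (a + b) = norm d w a + norm d w b" for d w a b
    by (simp_all add: norm_def ring_mapD[OF ring_map_mconst] algebra_simps)
  have \<Psi>: "\<Psi> q = (\<Sum>d\<le>N. lin_ext (norm d) (poly.coeff q d))" if "Polynomial.degree q \<le> N" for q N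
    unfolding \<Psi>_def by (rule sum.mono_neutral_left) (use that in \<open>auto simp: coeff_eq_0\<close>)
  have \<Psi>_add: "\<Psi> (q + q') = \<Psi> q + \<Psi> q'" for q q'
  proof -
    let ?N = "max (Polynomial.degree q) (Polynomial.degree q')"
    have "\<Psi> (q + q') = (\<Sum>d\<le>?N. lin_ext (norm d) (poly.coeff (q + q') d))"
      by (rule \<Psi>) (rule degree_add_le_max)
    then show ?thesis
      by (simp add: \<Psi>[of q ?N] \<Psi>[of q' ?N] lin_ext_add norm sum.distrib)
  qed
  have \<Psi>_monom: "\<Psi> (Polynomial.monom (single w a) d) = norm d w a" for w a d
  proof -
    have "\<Psi> (Polynomial.monom (single w a) d) =
      (\<Sum>i\<le>d. lin_ext (norm i) (poly.coeff (Polynomial.monom (single w a) d) i))"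
      by (rule \<Psi>) (rule degree_monom_le)
    also have "\<dots> = (\<Sum>i\<le>d. if i = d then lin_ext (norm i) (single w a) else 0)"
      by (intro sum.cong) (auto simp: coeff_monom)
    finally show ?thesis by (simp add: lin_ext_single norm)
  qed
  have key: "\<Psi> (to_rees (inv_subst q)) - inv_subst q \<in> relation_ideal" for q :: "('n, ('n, 'k) mpoly) mpoly"
  proof (induction q rule: poly_mapping_single_induct)
    case (single \<alpha> a)
    show ?case
    proof (induction a rule: poly_mapping_single_induct)
      case (single u c)
      let ?w = "u + comb \<alpha>" and ?d = "mdeg \<alpha>"
      have subst: "inv_subst (single \<alpha> (single u c)) = mconst (mconst c) * rees_monomial u \<alpha>"
        unfolding meval_single[OF ring_map_mconst] rees_monomial_def
        by (simp add: mconst_mult_mono_poly[symmetric] ring_mapD[OF ring_map_mconst] mult.assoc)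
      have "to_rees (inv_subst (single \<alpha> (single u c))) = Polynomial.monom (single ?w c) ?d"
        unfolding subst
        by (simp add: ring_mapD[OF ring_map_to_rees] to_rees_rees_monomial smult_monom mconst_mult_mono_poly)
      then have "\<Psi> (to_rees (inv_subst (single \<alpha> (single u c)))) = norm ?d ?w c"
        by (simp add: \<Psi>_monom)
      moreover have "case rep ?w ?d of (u', \<alpha>') \<Rightarrow> u' + comb \<alpha>' = ?w \<and> mdeg \<alpha>' = ?d"
        unfolding rep_def by (rule someI[of _ "(u, \<alpha>)"]) simp
      then have "rees_monomial (fst (rep ?w ?d)) (snd (rep ?w ?d)) - rees_monomial u \<alpha> \<in>
        (relation_ideal :: (('n, 'k) mpoly, ('n, 'k) mpoly) mpoly set)"
        by (intro rees_monomial_cong[OF \<open>linked\<close>]) (auto split: prod.splits)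
      then have "mconst (mconst c) * (rees_monomial (fst (rep ?w ?d)) (snd (rep ?w ?d)) - rees_monomial u \<alpha>) \<in> relation_ideal"
        by (intro relation_idealD(3) sym_free_closed(3))
      ultimately show ?case unfolding subst norm_def by (simp add: right_diff_distrib)
    next
      case zero
      have "\<Psi> 0 = 0" by (simp add: \<Psi>_def)
      then show ?case by (simp add: hom relation_idealD(1) ring_mapD[OF ring_map_to_rees])
    next
      case (add a b)
      from relation_idealD(2)[OF add] show ?case
        by (simp add: single_add hom ring_mapD[OF ring_map_to_rees] \<Psi>_add algebra_simps)
    qed
  next
    case zero
    have "\<Psi> 0 = 0" by (simp add: \<Psi>_def)
    then show ?case by (simp add: hom relation_idealD(1) ring_mapD[OF ring_map_to_rees])
  next
    case (add a b)
    from relation_idealD(2)[OF add] show ?case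
      by (simp add: hom ring_mapD[OF ring_map_to_rees] \<Psi>_add algebra_simps)
  qed
  obtain q where q: "p - inv_subst q \<in> relation_ideal" using p(1) by (rule inv_subst_surj)
  have "to_rees (p - inv_subst q) = 0"
    by (rule sym_relations_kernel[OF ideal_ideal_of ring_map_const_poly _ _ q]) auto
  then have "to_rees (inv_subst q) = 0" using p(2) by (simp add: ring_mapD[OF ring_map_to_rees])
  then have "inv_subst q \<in> relation_ideal"
    using relation_idealD(4)[OF key[of q]] by (simp add: \<Psi>_def)
  from relation_idealD(2)[OF q this] show "p \<in> relation_ideal" by simp
qed

text \<open>Let \<open>e = ab\<close> and \<open>f = cd\<close> be disjoint edges without a linking edge. The point with
  \<open>x_e = T_c = T_d = 1\<close> and all other coordinates 0 satisfies the relations of the symmetric algebra,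
  since a relation between \<open>x_e^m T_c\<close> and another monomial would require an edge from \<open>c\<close> to an end of
  \<open>e\<close>. It is not a zero of \<open>x_e T_c T_d - x_f T_a T_b\<close>, whose image in the Rees algebra is 0.\<close>

theorem linear_type_imp_linked:
  assumes lt: "linear_type (inv_ideal :: ('n, 'k::field) mpoly set)"
  shows linked
proof (rule ccontr)
  assume "\<not> linked"
  then obtain e f where disj: "keys (F e) \<inter> keys (F f) = {}"
    and unlinked: "\<And>g. keys (F g) \<inter> keys (F f) \<noteq> {} \<Longrightarrow> keys (F g) \<inter> keys (F e) = {}"
    unfolding linked_def by blast
  \<comment> \<open>At the point \<open>\<xi>\<close> the monomial \<open>x^w\<close> has value 1 if \<open>w\<close> is a multiple of \<open>e\<close> and 0 otherwise;
    \<open>\<psi> h\<close> is the value of the symbol of \<open>h\<close>, and \<open>Z\<close> collects the monomials of the ideal on which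
    it is 1.\<close>
  define Z where "Z = {single e m + G x | m x. x \<in> keys (F f)}"
  define \<xi> :: "'n \<Rightarrow> 'k" where "\<xi> j = (if j = e then 1 else 0)" for j
  define \<psi> :: "('n, 'k) mpoly \<Rightarrow> 'k" where "\<psi> = lin_ext (\<lambda>w a. if w \<in> Z then a else 0)"
  let ?c = "meval (\<lambda>x. x) \<xi>"
  note c = ring_map_meval[OF ring_map_id, of \<xi>]
  have \<xi>: "monval \<xi> w = (if w = single e (lookup w e) then 1 else 0)" for w
  proof (cases "keys w \<subseteq> {e}")
    case True
    then have "w = single e (lookup w e)"
      by (intro poly_mapping_eqI) (auto simp: lookup_single when_def in_keys_iff)
    then show ?thesis by (metis \<xi>_def monval_single power_one)
  next
    case False
    then obtain j where j: "j \<in> keys w" "j \<noteq> e" by auto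
    then have "monval \<xi> w = 0"
      unfolding monval_def by (intro prod_zero) (auto simp: \<xi>_def in_keys_iff intro!: bexI[of _ j])
    moreover have "w \<noteq> single e (lookup w e)"
      using j by (metis in_keys_iff lookup_single_not_eq)
    ultimately show ?thesis by simp
  qed
  \<comment> \<open>Otherwise \<open>w\<close> contains an edge at \<open>x\<close>; counting ends, its other end lies on \<open>e\<close>, so it links
    \<open>e\<close> and \<open>f\<close>.\<close>
  have key: "w = single e m \<and> v = x"
    if x: "x \<in> keys (F f)" and eq: "w + G v = single e m + G x" for w v m x
  proof -
    have v: "vdeg w i + lookup (unit_vec v) i = m * lookup (F e) i + lookup (unit_vec x) i" for i
      using arg_cong[OF eq, of "\<lambda>w. vdeg w i"] by (simp add: vdeg_add vdeg_G)
    have [simp]: "lookup (F e) x = 0" using x disj by (auto simp: in_keys_iff)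
    have "v = x"
    proof (rule ccontr)
      assume "v \<noteq> x"
      then have w1: "vdeg w x = 1" using v[of x] by (simp add: lookup_single)
      then obtain g where g: "lookup w g > 0" "x \<in> keys (F g)" using vdeg_pos[of w x] by auto
      then obtain y where Fg: "F g = unit_vec x + unit_vec y" using edge_split by metis
      have "keys (F g) \<inter> keys (F e) = {}" using x g by (intro unlinked) auto
      then have [simp]: "lookup (F e) y = 0" unfolding Fg keys_edge by (auto simp: in_keys_iff)
      have le: "lookup (F g) z \<le> vdeg w z" for z
        using vdeg_ge[of w g z] g(1) by (metis Suc_leI dual_order.trans mult_le_mono1 mult_1 One_nat_def)
      show False
      proof (cases "y = x")
        case True
        with le[of x] w1 show ?thesis by (simp add: Fg lookup_add)
      next
        case False
        with le[of y] v[of y] show ?thesis by (simp add: Fg lookup_add lookup_single)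
      qed
    qed
    moreover from this have "w = single e m" using v by (intro vdeg_inject) simp
    ultimately show ?thesis by simp
  qed
  have Z: "w + G v \<in> Z \<longleftrightarrow> w = single e (lookup w e) \<and> v \<in> keys (F f)" for w v
  proof
    assume "w + G v \<in> Z"
    then obtain m x where "x \<in> keys (F f)" "w + G v = single e m + G x" unfolding Z_def by auto
    with key[of x w v m] show "w = single e (lookup w e) \<and> v \<in> keys (F f)" by auto
  next
    assume "w = single e (lookup w e) \<and> v \<in> keys (F f)"
    then have "w + G v = single e (lookup w e) + G v" "v \<in> keys (F f)" by auto
    then show "w + G v \<in> Z" unfolding Z_def by blast
  qed
  have \<psi>_add: "\<psi> (a + b) = \<psi> a + \<psi> b" for a b
    unfolding \<psi>_def by (rule lin_ext_add) auto
  have \<psi>_single: "\<psi> (single w a) = (if w \<in> Z then a else 0)" for w a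
    unfolding \<psi>_def by (rule lin_ext_single) auto
  have \<psi>_zero: "\<psi> 0 = 0" by (simp add: \<psi>_def)
  have \<psi>_sum: "\<psi> (\<Sum>i\<in>M. h i) = (\<Sum>i\<in>M. \<psi> (h i))" for M :: "'n set" and h
    by (induction M rule: infinite_finite_induct) (simp_all add: \<psi>_add \<psi>_zero)
  have \<psi>_gen: "\<psi> (a * inv_gen v) = ?c a * (if v \<in> keys (F f) then 1 else 0)" for a v
  proof (induction a rule: poly_mapping_single_induct)
    case (single w x)
    have "\<psi> (single w x * inv_gen v) = (if w + G v \<in> Z then x else 0)"
      by (simp add: mono_poly_def mult_single \<psi>_single)
    then show ?case unfolding Z meval_single[OF ring_map_id] \<xi> by auto
  qed (simp_all add: \<psi>_zero \<psi>_add ring_mapD[OF c] algebra_simps)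
  have \<psi>_mult: "\<psi> (a * h) = ?c a * \<psi> h" if h: "h \<in> inv_ideal" for a h
  proof -
    from h obtain b where b: "h = (\<Sum>j\<in>UNIV. b j * inv_gen j)" unfolding mem_ideal_of_range_iff by auto
    have "\<psi> (a * h) = (\<Sum>j\<in>UNIV. \<psi> ((a * b j) * inv_gen j))"
      by (simp add: b sum_distrib_left \<psi>_sum mult.assoc)
    also have "\<dots> = ?c a * (\<Sum>j\<in>UNIV. \<psi> (b j * inv_gen j))"
      unfolding \<psi>_gen by (simp add: ring_mapD[OF c] sum_distrib_left mult.assoc)
    finally show ?thesis by (simp add: b \<psi>_sum)
  qed
  let ?p = "rees_monomial (unit_vec e) (F f) - rees_monomial (unit_vec f) (F e)
    :: (('n, 'k) mpoly, ('n, 'k) mpoly) mpoly"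
  have "unit_vec e + comb (F f) = unit_vec f + comb (F e)"
    by (subst exponent_eq_iff) (simp_all add: deg_F)
  then have "to_rees ?p = 0"
    by (simp add: ring_mapD[OF ring_map_to_rees] to_rees_rees_monomial deg_F)
  moreover have "?p \<in> carrier (sym_free inv_ideal)"
    by (intro sym_free_closed rees_monomial_mem)
  ultimately have "?p \<in> relation_ideal"
    using lt unfolding linear_type_iff[OF ideal_ideal_of] by blast
  then have "meval ?c \<psi> ?p = 0"
    by (intro sym_relations_kernel[OF ideal_ideal_of c]) (auto simp: \<psi>_add \<psi>_mult)
  moreover have "meval ?c \<psi> (rees_monomial u \<alpha>) = monval \<xi> u * monval (\<lambda>v. if v \<in> keys (F f) then 1 else 0) \<alpha>" for u \<alpha>
    using \<psi>_gen[of 1]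
    by (simp add: rees_monomial_def ring_mapD[OF ring_map_meval[OF c]] meval_mconst[OF c] meval_mvar[OF c]
        ring_map_monval[OF ring_map_meval[OF c]] meval_mono_poly[OF ring_map_id] ring_mapD[OF c])
  moreover have "monval (\<lambda>v. if v \<in> keys (F f) then 1 else 0) (F f) = (1 :: 'k)"
    by (simp add: monval_def)
  moreover have "f \<noteq> e" using disj keys_F_nonempty by auto
  ultimately show False by (simp add: ring_mapD[OF ring_map_meval[OF c]] \<xi>_def)
qed

end

section \<open>Linear presentation of the quadratic ideal\<close>

lemma module_vector: "module ((*s) :: 'a::comm_ring_1 \<Rightarrow> 'a ^ 'n \<Rightarrow> 'a ^ 'n)"
  by unfold_locales (simp_all add: vec_eq_iff algebra_simps)

lemma lookup_mult_single_add:
  fixes p :: "('n, 'k::comm_ring_1) mpoly"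
  shows "lookup (p * single k 1) (m + k) = lookup p m"
  by (induction p rule: poly_mapping_single_induct)
     (auto simp: mult_single lookup_single when_def lookup_add distrib_right)

context cremona_quadrics
begin

abbreviation gen :: "'n \<Rightarrow> ('n, 'k::field) mpoly"
  where "gen j \<equiv> mono_poly (F j)"

abbreviation linear_syzygies :: "(('n, 'k::field) mpoly ^ 'n) set"
  where "linear_syzygies \<equiv> {z \<in> syzygies gen. \<forall>j. is_form 1 (z $ j)}"

abbreviation linear_span :: "(('n, 'k::field) mpoly ^ 'n) set"
  where "linear_span \<equiv> module.span (*s) linear_syzygies"

lemmas span_rules =
  module.span_zero[OF module_vector] module.span_add[OF module_vector]
  module.span_scale[OF module_vector] module.span_diff[OF module_vector]

lemma gen_mult: "mono_poly u * gen j = mono_poly (u + F j)"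
  by (simp add: mono_poly_add)

lemma linear_span_subset: "(linear_span :: (('n, 'k::field) mpoly ^ 'n) set) \<subseteq> syzygies gen"
proof (rule module.span_minimal[OF module_vector])
  show "module.subspace (*s) (syzygies gen :: (('n, 'k) mpoly ^ 'n) set)"
    unfolding module.subspace_def[OF module_vector]
  proof (intro conjI ballI allI)
    fix x y :: "('n, 'k) mpoly ^ 'n" and c
    assume x: "x \<in> syzygies gen"
    then show "c *s x \<in> syzygies gen"
      by (auto simp: syzygies_def mult.assoc sum_distrib_left[symmetric])
    assume "y \<in> syzygies gen"
    with x show "x + y \<in> syzygies gen"
      by (auto simp: syzygies_def distrib_right sum.distrib)
  qed (simp add: syzygies_def)
qed auto

text \<open>For the edges \<open>pa\<close> and \<open>pb\<close> this is a multiple of the linear syzygy that expresses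
  \<open>x_b (x_p x_a) = x_a (x_p x_b)\<close>.\<close>

lemma adjacent_pair_syzygy:
  assumes meet: "keys (F e) \<inter> keys (F f) \<noteq> {}" and eq: "u + F e = v + F f"
  shows "axis e (mono_poly u) - axis f (mono_poly v) \<in> (linear_span :: (('n, 'k::field) mpoly ^ 'n) set)"
proof (cases "e = f")
  case True
  with eq show ?thesis by (simp add: span_rules)
next
  case False
  from meet obtain p where p: "p \<in> keys (F e)" "p \<in> keys (F f)" by auto
  obtain a b where e: "F e = unit_vec p + unit_vec a" and f: "F f = unit_vec p + unit_vec b"
    using p by (metis edge_split)
  have "a \<noteq> b" using False e f inj_F by (metis injD)
  have "unit_vec p + (u + unit_vec a) = unit_vec p + (v + unit_vec b)"
    using eq by (simp add: e f ac_simps)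
  then have eq': "u + unit_vec a = v + unit_vec b" by (rule add_left_imp_eq)
  have "lookup u b > 0"
    using arg_cong[OF eq', of "\<lambda>m. lookup m b"] \<open>a \<noteq> b\<close> by (simp add: lookup_add lookup_single)
  then obtain w where u: "u = unit_vec b + w" by (rule unit_vec_dvd)
  with eq' have "unit_vec b + v = unit_vec b + (unit_vec a + w)" by (simp add: ac_simps)
  then have v: "v = unit_vec a + w" by (rule add_left_imp_eq)
  let ?l = "axis e (mono_poly (unit_vec b)) - axis f (mono_poly (unit_vec a)) :: ('n, 'k) mpoly ^ 'n"
  have "(\<Sum>j\<in>UNIV. ?l $ j * gen j) = mono_poly (unit_vec b) * gen e - mono_poly (unit_vec a) * gen f"
    by (simp add: axis_def left_diff_distrib sum_subtractf mult_delta_left)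
  also have "\<dots> = 0"
    unfolding gen_mult by (simp add: e f algebra_simps)
  finally have "?l \<in> syzygies gen" by (simp add: syzygies_def)
  moreover have "is_form 1 (?l $ j)" for j
    using False by (auto simp: axis_def is_form_def mono_poly_def in_keys_iff lookup_single when_def split: if_splits)
  ultimately have "?l \<in> linear_span"
    by (intro module.span_base[OF module_vector]) auto
  then have "mono_poly w *s ?l \<in> linear_span" by (rule span_rules)
  also have "mono_poly w *s ?l = axis e (mono_poly u) - axis f (mono_poly v)"
    by (simp add: vec_eq_iff axis_def u v mono_poly_add algebra_simps)
  finally show ?thesis .
qed

text \<open>A common multiple of two disjoint edges is also a multiple of any edge that links them.\<close>

lemma pair_syzygy:
  assumes linked and eq: "u + F e = v + F f"
  shows "axis e (mono_poly u) - axis f (mono_poly v) \<in> (linear_span :: (('n, 'k::field) mpoly ^ 'n) set)"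
proof (cases "keys (F e) \<inter> keys (F f) = {}")
  case True
  with \<open>linked\<close> obtain g p q where g: "p \<in> keys (F g)" "q \<in> keys (F g)"
    and pq: "p \<in> keys (F e)" "q \<in> keys (F f)" unfolding linked_def by blast
  obtain a b where e: "F e = unit_vec p + unit_vec a" and f: "F f = unit_vec q + unit_vec b"
    using pq by (metis edge_split)
  from True pq have "p \<noteq> q" by auto
  with g have Fg: "F g = unit_vec p + unit_vec q" by (rule edge_eq)
  have "lookup (F e) q = 0" using True pq by (auto simp: in_keys_iff)
  then have "lookup u q > 0"
    using arg_cong[OF eq, of "\<lambda>m. lookup m q"] by (simp add: lookup_add f)
  then obtain w where u: "u = unit_vec q + w" by (rule unit_vec_dvd)
  have eg: "u + F e = (unit_vec a + w) + F g" by (simp add: u e Fg algebra_simps)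
  have "axis e (mono_poly u) - axis g (mono_poly (unit_vec a + w)) \<in> (linear_span :: (('n, 'k) mpoly ^ 'n) set)"
    by (rule adjacent_pair_syzygy[OF _ eg]) (use g pq in blast)
  moreover have "axis g (mono_poly (unit_vec a + w)) - axis f (mono_poly v) \<in> (linear_span :: (('n, 'k) mpoly ^ 'n) set)"
    by (rule adjacent_pair_syzygy) (use g pq eq eg in auto)
  ultimately show ?thesis
    using span_rules(2) by fastforce
qed (use adjacent_pair_syzygy eq in blast)

text \<open>\<open>V m\<close> is a chosen way to write the monomial \<open>m\<close> as a multiple of a generator. Replacing each
  term of a syzygy by the chosen one for the same monomial changes it by pair syzygies, and it makes
  all terms cancel.\<close>

theorem linked_imp_linearly_presented:
  assumes linked
  shows "linearly_presented (gen :: 'n \<Rightarrow> ('n, 'k::field) mpoly)"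
  unfolding linearly_presented_def
proof (intro equalityI linear_span_subset subsetI)
  fix z :: "('n, 'k) mpoly ^ 'n" assume z: "z \<in> syzygies gen"
  define rep where "rep m = (SOME (j, u). m = u + F j)" for m
  define V :: "'n monomial \<Rightarrow> ('n, 'k) mpoly ^ 'n"
    where "V m = axis (fst (rep m)) (mono_poly (snd (rep m)))" for m
  define \<Psi> :: "('n, 'k) mpoly \<Rightarrow> ('n, 'k) mpoly ^ 'n" where "\<Psi> = lin_ext (\<lambda>m a. mconst a *s V m)"
  have 0: "mconst 0 *s V m = 0" for m by (simp add: vec_eq_iff ring_mapD[OF ring_map_mconst])
  have \<Psi>_add: "\<Psi> (p + q) = \<Psi> p + \<Psi> q" for p q
    unfolding \<Psi>_def
    by (rule lin_ext_add) (simp_all add: 0 ring_mapD[OF ring_map_mconst] vec_eq_iff algebra_simps)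
  have \<Psi>_single: "\<Psi> (single m a) = mconst a *s V m" for m a
    unfolding \<Psi>_def by (rule lin_ext_single) (rule 0)
  have \<Psi>_zero: "\<Psi> 0 = 0" by (simp add: \<Psi>_def)
  have \<Psi>_sum: "\<Psi> (\<Sum>i\<in>M. h i) = (\<Sum>i\<in>M. \<Psi> (h i))" for M :: "'n set" and h
    by (induction M rule: infinite_finite_induct) (simp_all add: \<Psi>_add \<Psi>_zero)
  have axis_add: "axis j (p + q) = axis j p + (axis j q :: ('n, 'k) mpoly ^ 'n)" for j p q
    by (simp add: vec_eq_iff axis_def)
  have key: "axis j p - \<Psi> (p * gen j) \<in> linear_span" for j p
  proof (induction p rule: poly_mapping_single_induct)
    case (single u a)
    let ?m = "u + F j"
    have "case rep ?m of (j', u') \<Rightarrow> ?m = u' + F j'"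
      unfolding rep_def by (rule someI[of _ "(j, u)"]) simp
    then have "axis j (mono_poly u) - V ?m \<in> linear_span"
      unfolding V_def by (intro pair_syzygy[OF \<open>linked\<close>]) (auto split: prod.splits)
    then have "mconst a *s (axis j (mono_poly u) - V ?m) \<in> linear_span" by (rule span_rules)
    also have "mconst a *s (axis j (mono_poly u) - V ?m) = axis j (single u a) - \<Psi> (single u a * gen j)"
      by (simp add: mono_poly_def mult_single \<Psi>_single vec_eq_iff axis_def algebra_simps)
         (simp add: mconst_def mult_single)
    finally show ?case .
  next
    case (add p q)
    from span_rules(2)[OF add] show ?case
      by (simp add: axis_add \<Psi>_add algebra_simps)
  next
    case zero
    have axis_0: "axis j 0 = (0 :: ('n, 'k) mpoly ^ 'n)" by (simp add: vec_eq_iff axis_def)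
    show ?case unfolding axis_0 mult_zero_left \<Psi>_zero diff_0_right by (rule span_rules)
  qed
  have "(\<Sum>j\<in>UNIV. axis j (z $ j) - \<Psi> (z $ j * gen j)) \<in> linear_span"
    by (rule module.span_sum[OF module_vector]) (rule key)
  also have "(\<Sum>j\<in>UNIV. axis j (z $ j) - \<Psi> (z $ j * gen j)) = (\<Sum>j\<in>UNIV. axis j (z $ j)) - \<Psi> (\<Sum>j\<in>UNIV. z $ j * gen j)"
    by (simp add: sum_subtractf \<Psi>_sum)
  also have "\<dots> = z"
    using z by (simp add: syzygies_def \<Psi>_zero vec_eq_iff axis_def)
  finally show "z \<in> linear_span" .
qed

text \<open>If \<open>e\<close> and \<open>f\<close> are disjoint and not linked, their syzygy has the coefficient 1 at \<open>x^f\<close> in the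
  component \<open>e\<close>. A multiple of a linear syzygy \<open>l\<close> has the coefficient 0 there, because \<open>l_e\<close> does not
  involve the ends of \<open>f\<close>.\<close>

theorem linearly_presented_imp_linked:
  assumes lp: "linearly_presented (gen :: 'n \<Rightarrow> ('n, 'k::field) mpoly)"
  shows linked
proof (rule ccontr)
  assume "\<not> linked"
  then obtain e f where disj: "keys (F e) \<inter> keys (F f) = {}"
    and unlinked: "\<And>g. keys (F g) \<inter> keys (F f) \<noteq> {} \<Longrightarrow> keys (F g) \<inter> keys (F e) = {}"
    unfolding linked_def by blast
  \<comment> \<open>The only generator that divides \<open>x_c x^e\<close> is \<open>x^e\<close> itself, so the coefficient of this monomial
    in the syzygy equation is the single summand \<open>l_e\<close> contributes.\<close>
  have coeff: "lookup (l $ e) (unit_vec c) = 0"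
    if l: "l \<in> linear_syzygies" and c: "c \<in> keys (F f)" for l :: "('n, 'k) mpoly ^ 'n" and c
  proof -
    let ?m = "unit_vec c + F e"
    have "lookup (l $ g * gen g) ?m = 0" if "g \<noteq> e" for g
    proof (rule ccontr)
      assume "lookup (l $ g * gen g) ?m \<noteq> 0"
      then have "?m \<in> keys (l $ g * gen g)" by (simp add: in_keys_iff)
      then obtain w where w: "?m = w + F g" "w \<in> keys (l $ g)"
        using keys_mult[of "l $ g" "gen g"] by (auto simp: mono_poly_def)
      then have "mdeg w = 1" using l by (auto simp: is_form_def)
      have "lookup (F g) c > 0"
      proof (rule ccontr)
        assume "\<not> ?thesis"
        then have "lookup w c > 0"
          using arg_cong[OF w(1), of "\<lambda>m. lookup m c"] by (simp add: lookup_add)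
        then obtain w' where "w = unit_vec c + w'" by (rule unit_vec_dvd)
        with \<open>mdeg w = 1\<close> have "w = unit_vec c" by (simp add: mdeg_add)
        with w(1) that inj_F show False by (auto dest: injD)
      qed
      with c have "keys (F g) \<inter> keys (F e) = {}" by (intro unlinked) (auto simp: in_keys_iff)
      then have "lookup (F e) i \<le> lookup w i" for i
        using arg_cong[OF w(1), of "\<lambda>m. lookup m i"]
        by (cases "lookup (F g) i = 0") (auto simp: lookup_add in_keys_iff disjoint_iff)
      then have "mdeg (F e) \<le> mdeg w" unfolding mdeg_UNIV by (intro sum_mono)
      with \<open>mdeg w = 1\<close> show False by (simp add: deg_F)
    qed
    then have "(\<Sum>g\<in>UNIV. lookup (l $ g * gen g) ?m) = lookup (l $ e * gen e) ?m"
      by (subst sum.remove[of _ e]) auto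
    moreover have "(\<Sum>g\<in>UNIV. lookup (l $ g * gen g) ?m) = lookup (\<Sum>g\<in>UNIV. l $ g * gen g) ?m"
      by (simp add: lookup_sum)
    moreover have "(\<Sum>g\<in>UNIV. l $ g * gen g) = 0" using l by (auto simp: syzygies_def)
    ultimately show ?thesis by (simp add: mono_poly_def lookup_mult_single_add)
  qed
  \<comment> \<open>The factor \<open>p\<close> makes the condition stable under scaling.\<close>
  have vanish: "\<forall>p. lookup (p * z $ e) (F f) = 0" if "z \<in> linear_span" for z :: "('n, 'k) mpoly ^ 'n"
    using that
  proof (rule module.span_induct[OF module_vector])
    show "module.subspace (*s) {z :: ('n, 'k) mpoly ^ 'n. \<forall>p. lookup (p * z $ e) (F f) = 0}"
      unfolding module.subspace_def[OF module_vector]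
      by (auto simp: distrib_left lookup_add mult.assoc[symmetric])
  next
    fix l :: "('n, 'k) mpoly ^ 'n" assume l: "l \<in> linear_syzygies"
    show "\<forall>p. lookup (p * l $ e) (F f) = 0"
    proof (intro allI, rule ccontr)
      fix p assume "lookup (p * l $ e) (F f) \<noteq> 0"
      then have "F f \<in> keys (p * l $ e)" by (simp add: in_keys_iff)
      then obtain a w where w: "F f = a + w" "w \<in> keys (l $ e)"
        using keys_mult[of p "l $ e"] by blast
      then have "mdeg w = 1" using l by (auto simp: is_form_def)
      then obtain c where c: "lookup w c > 0"
        by (metis gr0I mdeg_zero poly_mapping_eqI lookup_zero zero_neq_one)
      then obtain w' where "w = unit_vec c + w'" by (rule unit_vec_dvd)
      with \<open>mdeg w = 1\<close> have "w = unit_vec c" by (simp add: mdeg_add)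
      moreover have "c \<in> keys (F f)" using c by (simp add: w(1) in_keys_iff lookup_add)
      ultimately show False using coeff[OF l] w(2) by (simp add: in_keys_iff)
    qed
  qed
  let ?z = "axis e (mono_poly (F f)) - axis f (mono_poly (F e)) :: ('n, 'k) mpoly ^ 'n"
  have "(\<Sum>j\<in>UNIV. ?z $ j * gen j) = mono_poly (F f) * gen e - mono_poly (F e) * gen f"
    by (simp add: axis_def left_diff_distrib sum_subtractf mult_delta_left)
  then have "?z \<in> syzygies gen" by (simp add: syzygies_def mult.commute)
  then have "?z \<in> linear_span" using lp unfolding linearly_presented_def by blast
  then have "lookup (1 * ?z $ e) (F f) = 0" using vanish by blast
  moreover have "e \<noteq> f" using disj keys_F_nonempty by auto
  ultimately show False by (simp add: axis_def mono_poly_def)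
qed

end

section \<open>Distances in graphs\<close>

lemma enat_INF_le_iff:
  fixes h :: "'b \<Rightarrow> enat"
  shows "(INF x\<in>A. h x) \<le> enat n \<longleftrightarrow> (\<exists>x\<in>A. h x \<le> enat n)"
proof
  assume le: "(INF x\<in>A. h x) \<le> enat n"
  then have "h ` A \<noteq> {}" by (auto simp: Inf_enat_def)
  then have "(INF x\<in>A. h x) \<in> h ` A"
    unfolding Inf_enat_def by (auto intro: LeastI_ex simp del: image_is_empty)
  with le show "\<exists>x\<in>A. h x \<le> enat n" by auto
qed (meson INF_lower2)

lemma gdist_le_iff: "gdist adj x y \<le> enat n \<longleftrightarrow> (\<exists>p. path_betw adj x y p \<and> length p \<le> Suc n)"
  unfolding gdist_def enat_INF_le_iff by auto

lemma dist_to_le_iff: "dist_to E C x \<le> enat n \<longleftrightarrow> (\<exists>y\<in>C. gdist (\<lambda>u v. {u, v} \<in> E) x y \<le> enat n)"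
  unfolding dist_to_def enat_INF_le_iff ..

text \<open>A path does not repeat vertices; if \<open>w\<close> already lies on the path from \<open>x\<close>, the part from \<open>w\<close> on is
  taken.\<close>

lemma gdist_le_step:
  assumes "adj w x" "gdist adj x y \<le> enat n"
  shows "gdist adj w y \<le> enat (Suc n)"
proof -
  from assms(2) obtain p where p: "path_betw adj x y p" "length p \<le> Suc n"
    unfolding gdist_le_iff by auto
  show ?thesis
  proof (cases "w \<in> set p")
    case False
    then have "path_betw adj w y (w # p)"
      using p assms(1) by (cases p) (auto simp: path_betw_def)
    then show ?thesis unfolding gdist_le_iff using p(2) by (intro exI[of _ "w # p"]) simp
  next
    case True
    then obtain p1 p2 where split: "p = p1 @ w # p2" by (auto simp: in_set_conv_decomp)
    then have "path_betw adj w y (w # p2)"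
      using p by (auto simp: path_betw_def successively_append_iff split: if_splits)
    then show ?thesis unfolding gdist_le_iff using p(2) split by (intro exI[of _ "w # p2"]) simp
  qed
qed

lemma gdist_le_SucE:
  assumes "gdist adj x y \<le> enat (Suc n)" "x \<noteq> y"
  obtains w where "adj x w" "gdist adj w y \<le> enat n"
proof -
  from assms(1) obtain p where p: "path_betw adj x y p" "length p \<le> Suc (Suc n)"
    unfolding gdist_le_iff by auto
  then obtain p' where p': "p = x # p'" by (cases p) (auto simp: path_betw_def)
  with p assms(2) obtain w p'' where w: "p' = w # p''" by (cases p') (auto simp: path_betw_def)
  show thesis
  proof (rule that)
    show "adj x w" using p by (simp add: p' w path_betw_def)
    have "path_betw adj w y (w # p'')" using p by (simp add: p' w path_betw_def)
    then show "gdist adj w y \<le> enat n"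
      unfolding gdist_le_iff using p(2) p' w by (intro exI[of _ "w # p''"]) simp
  qed
qed

lemma gdist_self: "gdist adj x x \<le> enat 0"
  unfolding gdist_le_iff by (rule exI[of _ "[x]"]) (simp add: path_betw_def)

lemma gdist_le_0D: "gdist adj x y \<le> enat 0 \<Longrightarrow> x = y"
  unfolding gdist_le_iff by (auto simp: path_betw_def le_Suc_eq length_Suc_conv)

definition linked_edges :: "'a set set \<Rightarrow> bool"
  where "linked_edges E \<longleftrightarrow>
    (\<forall>e\<in>E. \<forall>f\<in>E. e \<inter> f = {} \<longrightarrow> (\<exists>g\<in>E. g \<inter> e \<noteq> {} \<and> g \<inter> f \<noteq> {}))"

lemma edge_graph_diameter_le_2_iff:
  assumes "{} \<notin> E"
  shows "graph_diameter E (edge_graph_adj E) \<le> 2 \<longleftrightarrow> linked_edges E"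
proof -
  have "graph_diameter E (edge_graph_adj E) \<le> 2 \<longleftrightarrow>
      (\<forall>e\<in>E. \<forall>f\<in>E. gdist (edge_graph_adj E) e f \<le> enat 2)"
    by (simp add: graph_diameter_def SUP_le_iff numeral_eq_enat)
  also have "\<dots> \<longleftrightarrow> linked_edges E"
    unfolding linked_edges_def
  proof (intro iffI ballI impI)
    fix e f assume *: "\<forall>e\<in>E. \<forall>f\<in>E. gdist (edge_graph_adj E) e f \<le> enat 2"
      and ef: "e \<in> E" "f \<in> E" "e \<inter> f = {}"
    with assms have "e \<noteq> f" by auto
    moreover have "gdist (edge_graph_adj E) e f \<le> enat (Suc (Suc 0))"
      using * ef by (simp add: numeral_2_eq_2)
    ultimately obtain g where g: "edge_graph_adj E e g" "gdist (edge_graph_adj E) g f \<le> enat (Suc 0)"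
      by (metis gdist_le_SucE)
    then have "g \<noteq> f" using ef by (auto simp: edge_graph_adj_def)
    with g obtain h where "edge_graph_adj E g h" "gdist (edge_graph_adj E) h f \<le> enat 0"
      by (metis gdist_le_SucE)
    with g show "\<exists>g\<in>E. g \<inter> e \<noteq> {} \<and> g \<inter> f \<noteq> {}"
      by (intro bexI[of _ g]) (auto simp: edge_graph_adj_def dest: gdist_le_0D)
  next
    fix e f assume *: "\<forall>e\<in>E. \<forall>f\<in>E. e \<inter> f = {} \<longrightarrow> (\<exists>g\<in>E. g \<inter> e \<noteq> {} \<and> g \<inter> f \<noteq> {})"
      and ef: "e \<in> E" "f \<in> E"
    let ?A = "edge_graph_adj E"
    have le: "gdist ?A x y \<le> enat 2" if "gdist ?A x y \<le> enat n" "n \<le> 2" for x y n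
      using that by (meson enat_ord_simps(1) order_trans)
    show "gdist ?A e f \<le> enat 2"
    proof (cases "e \<inter> f = {}")
      case True
      from *[rule_format, OF ef True] obtain g where g: "g \<in> E" "g \<inter> e \<noteq> {}" "g \<inter> f \<noteq> {}" by auto
      from True g(3) have "e \<noteq> g" by blast
      with g ef have eg: "?A e g" unfolding edge_graph_adj_def by blast
      from True g(2) have "g \<noteq> f" by blast
      with g ef have gf: "?A g f" unfolding edge_graph_adj_def by blast
      have "gdist ?A e f \<le> enat (Suc (Suc 0))"
        by (rule gdist_le_step[where adj = ?A, OF eg gdist_le_step[where adj = ?A, OF gf gdist_self]])
      then show ?thesis by (simp add: numeral_2_eq_2)
    next
      case False
      show ?thesis
      proof (cases "e = f")
        case True
        then show ?thesis using le[OF gdist_self] by simp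
      next
        case neq: False
        with False ef have "?A e f" by (auto simp: edge_graph_adj_def)
        from le[OF gdist_le_step[where adj = ?A, OF this gdist_self]] show ?thesis by simp
      qed
    qed
  qed
  finally show ?thesis .
qed

section \<open>Connected graphs with a unique odd circuit\<close>

text \<open>If two positions carried the same edge, each would be the cyclic successor of the other, which only
  happens for length 2.\<close>

lemma circuit_edges_inj:
  assumes "circuit E c"
  shows "inj_on (\<lambda>i. {c ! i, c ! (Suc i mod length c)}) {..<length c}"
proof (rule inj_onI)
  let ?r = "length c"
  fix i j assume ij: "i \<in> {..<?r}" "j \<in> {..<?r}" and
    eq: "{c ! i, c ! (Suc i mod ?r)} = {c ! j, c ! (Suc j mod ?r)}"
  have nth: "c ! a = c ! b \<longleftrightarrow> a = b" if "a < ?r" "b < ?r" for a b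
    using that assms by (auto simp: circuit_def nth_eq_iff_index_eq)
  have r: "?r > 0" "?r \<noteq> 2" using assms by (auto simp: circuit_def)
  have "i = j \<or> (i = Suc j mod ?r \<and> Suc i mod ?r = j)"
    using eq nth ij r by (auto simp: doubleton_eq_iff)
  then show "i = j"
  proof
    assume *: "i = Suc j mod ?r \<and> Suc i mod ?r = j"
    show "i = j"
    proof (rule ccontr)
      assume "i \<noteq> j"
      with * ij r show False
        by (cases "Suc j = ?r"; cases "Suc i = ?r") auto
    qed
  qed
qed

text \<open>Connectedness is expressed by sets that are closed under adjacency, which is the form in which it
  is obtained from the parity of column sums.\<close>

locale odd_unicyclic_graph =
  fixes E :: "'a::finite set set" and circ :: "'a list"
  assumes edge: "e \<in> E \<Longrightarrow> \<exists>x y. e = {x, y}" and card_E: "card E = CARD('a)"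
    and circ: "circuit E circ" and odd: "odd (length circ)"
    and connected: "K \<noteq> {} \<Longrightarrow> (\<And>x y. {x, y} \<in> E \<Longrightarrow> x \<in> K \<Longrightarrow> y \<in> K) \<Longrightarrow> K = UNIV"
begin

abbreviation "r \<equiv> length circ"
abbreviation "C \<equiv> set circ"

lemma circ_nth: "i < r \<Longrightarrow> {circ ! i, circ ! (Suc i mod r)} \<in> E"
  and circ_distinct: "distinct circ" and circ_nonempty: "r > 0" "C \<noteq> {}"
  using circ by (auto simp: circuit_def)

lemma nth_circ_eq: "i < r \<Longrightarrow> j < r \<Longrightarrow> circ ! i = circ ! j \<longleftrightarrow> i = j"
  using circ_distinct by (simp add: nth_eq_iff_index_eq)

definition level :: "'a \<Rightarrow> nat"
  where "level x = the_enat (dist_to E C x)"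

lemma dist_to_step:
  assumes "{x, y} \<in> E" "dist_to E C x \<le> enat n"
  shows "dist_to E C y \<le> enat (Suc n)"
proof -
  have "{y, x} \<in> E" using assms(1) by (simp add: insert_commute)
  from gdist_le_step[where adj = "\<lambda>u v. {u, v} \<in> E", OF this] assms(2)
  show ?thesis unfolding dist_to_le_iff by blast
qed

lemma dist_to_eq_level: "dist_to E C x = enat (level x)"
proof -
  have "{x. \<exists>n. dist_to E C x \<le> enat n} = UNIV"
  proof (rule connected)
    have v: "circ ! 0 \<in> C" using circ_nonempty(1) by (rule nth_mem)
    then have "dist_to E C (circ ! 0) \<le> enat 0" unfolding dist_to_le_iff using gdist_self by fast
    then show "{x. \<exists>n. dist_to E C x \<le> enat n} \<noteq> {}" by auto
  qed (use dist_to_step in blast)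
  then obtain n where "dist_to E C x \<le> enat n" by auto
  then show ?thesis unfolding level_def by (cases "dist_to E C x") auto
qed

lemma level_step: "{x, y} \<in> E \<Longrightarrow> level y \<le> Suc (level x)"
  using dist_to_step[of x y "level x"] by (simp add: dist_to_eq_level)

lemma level_eq_0_iff: "level x = 0 \<longleftrightarrow> x \<in> C"
proof -
  have "dist_to E C x \<le> enat 0 \<longleftrightarrow> x \<in> C"
    unfolding dist_to_le_iff using gdist_self gdist_le_0D by metis
  then show ?thesis by (simp add: dist_to_eq_level)
qed

lemma ex_parent:
  assumes "x \<notin> C"
  shows "\<exists>y. {x, y} \<in> E \<and> level x = Suc (level y)"
proof -
  from assms level_eq_0_iff obtain n where n: "level x = Suc n" by (metis not0_implies_Suc)
  then have "dist_to E C x \<le> enat (Suc n)" by (simp add: dist_to_eq_level)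
  then obtain v where v: "v \<in> C" "gdist (\<lambda>u v. {u, v} \<in> E) x v \<le> enat (Suc n)"
    unfolding dist_to_le_iff by auto
  with assms have "x \<noteq> v" by auto
  then obtain y where y: "{x, y} \<in> E" "gdist (\<lambda>u v. {u, v} \<in> E) y v \<le> enat n"
    using gdist_le_SucE[OF v(2)] by blast
  then have "dist_to E C y \<le> enat n" unfolding dist_to_le_iff using v by blast
  then have "level y \<le> n" by (simp add: dist_to_eq_level)
  moreover have "level x \<le> Suc (level y)" by (rule level_step) (use y in \<open>simp add: insert_commute\<close>)
  ultimately show ?thesis using y n by auto
qed

text \<open>An arbitrary neighbour that is closer to the circuit; \<open>edges_eq\<close> shows that there is only one.\<close>

definition parent :: "'a \<Rightarrow> 'a"
  where "parent x = (SOME y. {x, y} \<in> E \<and> level x = Suc (level y))"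

lemma parent:
  assumes "x \<notin> C"
  shows "{x, parent x} \<in> E" "level x = Suc (level (parent x))"
  using someI_ex[OF ex_parent[OF assms]] by (auto simp: parent_def)

text \<open>The edges from the vertices off the circuit to their parents are distinct, and so are the edges of
  the circuit; together these are as many as there are vertices, hence all edges.\<close>

lemma edges_eq:
  "E = (\<lambda>i. {circ ! i, circ ! (Suc i mod r)}) ` {..<r} \<union> (\<lambda>x. {x, parent x}) ` (- C)"
proof (rule card_subset_eq[symmetric])
  let ?A = "(\<lambda>i. {circ ! i, circ ! (Suc i mod r)}) ` {..<r}" and ?B = "(\<lambda>x. {x, parent x}) ` (- C)"
  show "?A \<union> ?B \<subseteq> E" using circ_nth parent by auto
  have "inj_on (\<lambda>x. {x, parent x}) (- C)"
  proof (rule inj_onI)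
    fix x y assume xy: "x \<in> - C" "y \<in> - C" "{x, parent x} = {y, parent y}"
    show "x = y"
    proof (rule ccontr)
      assume "x \<noteq> y"
      with xy have y: "y = parent x" and x: "x = parent y" by (auto simp: doubleton_eq_iff)
      have "level x = Suc (level y)" unfolding y using parent(2)[of x] xy(1) by simp
      moreover have "level y = Suc (level x)" unfolding x using parent(2)[of y] xy(2) by simp
      ultimately show False by simp
    qed
  qed
  then have "card ?B = card (- C)" by (rule card_image)
  also have "\<dots> = CARD('a) - r"
    by (simp add: Compl_eq_Diff_UNIV card_Diff_subset distinct_card[OF circ_distinct])
  finally have B: "card ?B = CARD('a) - r" .
  have A: "card ?A = r" by (simp add: card_image[OF circuit_edges_inj[OF circ]])
  have "e \<subseteq> C" if "e \<in> ?A" for e using that circ_nonempty by auto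
  then have "?A \<inter> ?B = {}" by blast
  then have "card (?A \<union> ?B) = card ?A + card ?B" by (intro card_Un_disjoint) auto
  also have "\<dots> = CARD('a)"
    unfolding A B using card_mono[of UNIV C] distinct_card[OF circ_distinct] by simp
  finally show "card (?A \<union> ?B) = card E" by (simp add: card_E)
qed simp

lemma edge_cases:
  assumes "{x, y} \<in> E"
  obtains "x \<in> C" "y \<in> C" | "x \<notin> C" "y = parent x" "level x = Suc (level y)"
    | "y \<notin> C" "x = parent y" "level y = Suc (level x)"
proof -
  from assms consider i where "i < r" "{x, y} = {circ ! i, circ ! (Suc i mod r)}"
    | z where "z \<notin> C" "{x, y} = {z, parent z}"
    by (subst (asm) edges_eq) auto
  then show thesis
  proof cases
    case 1
    then have "{x, y} \<subseteq> C" using circ_nonempty by auto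
    then show thesis using that(1) by auto
  next
    case 2
    with parent(2)[of z] that(2,3) show thesis by (auto simp: doubleton_eq_iff)
  qed
qed

lemma no_chord:
  assumes "{circ ! i, circ ! j} \<in> E" "i < r" "j < r"
  shows "j = Suc i mod r \<or> i = Suc j mod r"
proof -
  from assms(1) consider k where "k < r" "{circ ! i, circ ! j} = {circ ! k, circ ! (Suc k mod r)}"
    | z where "z \<notin> C" "{circ ! i, circ ! j} = {z, parent z}"
    by (subst (asm) edges_eq) auto
  then show ?thesis
  proof cases
    case 1
    then show ?thesis using assms nth_circ_eq circ_nonempty by (auto simp: doubleton_eq_iff)
  next
    case 2
    with assms show ?thesis by (auto simp: doubleton_eq_iff)
  qed
qed

lemma nbhd_edges_iff:
  "nbhd_edges E C j = {{x, y} | x y. {x, y} \<in> E \<and> level x = j - 1 \<and> level y = j}"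
  by (simp add: nbhd_edges_def dist_to_eq_level)

lemma nbhd_edges_empty_iff:
  assumes "k \<ge> 1"
  shows "(\<forall>j\<ge>k. nbhd_edges E C j = {}) \<longleftrightarrow> (\<forall>x. level x < k)"
proof
  assume *: "\<forall>j\<ge>k. nbhd_edges E C j = {}"
  show "\<forall>x. level x < k"
  proof (intro allI, rule ccontr)
    fix x assume "\<not> level x < k"
    then have "level x \<ge> k" by simp
    moreover from this have "x \<notin> C" using assms level_eq_0_iff[of x] by auto
    from parent[OF this] have "{parent x, x} \<in> nbhd_edges E C (level x)"
      unfolding nbhd_edges_iff
      by (intro CollectI exI[of _ "parent x"] exI[of _ x]) (simp add: insert_commute)
    ultimately show False using * by blast
  qed
qed (auto simp: nbhd_edges_iff, metis not_less)

lemma no_loop_off_circuit: "x \<notin> C \<Longrightarrow> {x} \<notin> E"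
proof
  assume x: "x \<notin> C" "{x} \<in> E"
  then have "{x, x} \<in> E" by simp
  then show False by (rule edge_cases) (use x in auto)
qed

text \<open>Apart from the edge to its parent, a vertex off the circuit only has edges to its children.\<close>

lemma branch_vertex_iff:
  assumes x: "x \<notin> C"
  shows "vertex_degree E x \<ge> 2 \<longleftrightarrow> (\<exists>y. y \<notin> C \<and> parent y = x)"
proof -
  let ?D = "{e \<in> E. x \<in> e}"
  have deg: "vertex_degree E x = card ?D"
    using no_loop_off_circuit[OF x] by (simp add: vertex_degree_def)
  show ?thesis unfolding deg
  proof
    assume "2 \<le> card ?D"
    then have "\<not> ?D \<subseteq> {{x, parent x}}"
      using card_mono[of "{{x, parent x}}" ?D] by auto
    then obtain e where e: "e \<in> E" "x \<in> e" "e \<noteq> {x, parent x}" by auto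
    then obtain y where y: "e = {x, y}" using edge[OF e(1)] by auto
    with e have "{x, y} \<in> E" by simp
    then show "\<exists>y. y \<notin> C \<and> parent y = x"
      by (rule edge_cases) (use x y e in auto)
  next
    assume "\<exists>y. y \<notin> C \<and> parent y = x"
    then obtain y where y: "y \<notin> C" "parent y = x" by auto
    from parent[OF y(1)] parent[OF x] y have "y \<noteq> parent x" "y \<noteq> x" by auto
    then have "{y, x} \<noteq> {x, parent x}" by (auto simp: doubleton_eq_iff)
    moreover have "{{y, x}, {x, parent x}} \<subseteq> ?D" using parent y x by auto
    ultimately show "2 \<le> card ?D"
      using card_mono[of ?D "{{y, x}, {x, parent x}}"] by simp
  qed
qed

lemma linkE:
  assumes "linked_edges E" "e \<in> E" "f \<in> E" "e \<inter> f = {}"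
  obtains p q where "p \<in> e" "q \<in> f" "{p, q} \<in> E"
proof -
  from assms(1)[unfolded linked_edges_def, rule_format, OF assms(2-4)]
  obtain g where g: "g \<in> E" "g \<inter> e \<noteq> {}" "g \<inter> f \<noteq> {}" by auto
  from g(2) obtain p where p: "p \<in> g" "p \<in> e" by blast
  from g(3) obtain q where q: "q \<in> g" "q \<in> f" by blast
  have "p \<noteq> q" using assms(4) p(2) q(2) by blast
  moreover obtain x y where "g = {x, y}" using edge[OF g(1)] by blast
  ultimately have "g = {p, q}" using p(1) q(1) by auto
  with g(1) have "{p, q} \<in> E" by simp
  with p(2) q(2) show thesis by (rule that)
qed

lemma linked_edgesI:
  assumes "\<And>e f. e \<in> E \<Longrightarrow> f \<in> E \<Longrightarrow> e \<inter> f = {} \<Longrightarrow> \<exists>p\<in>e. \<exists>q\<in>f. {p, q} \<in> E"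
  shows "linked_edges E"
  unfolding linked_edges_def
proof (intro ballI impI)
  fix e f assume "e \<in> E" "f \<in> E" "e \<inter> f = {}"
  from assms[OF this] obtain p q where "p \<in> e" "q \<in> f" "{p, q} \<in> E" by blast
  then show "\<exists>g\<in>E. g \<inter> e \<noteq> {} \<and> g \<inter> f \<noteq> {}"
    by (intro bexI[of _ "{p, q}"]) auto
qed

text \<open>Let \<open>y\<close> have distance at least 2. An edge that links \<open>{y, parent y}\<close> to an edge of the circuit
  leads from \<open>parent y\<close> to its parent, which would have to be an end of every edge of the circuit.\<close>

lemma linked_level_le_1:
  assumes L: "linked_edges E" and r: "r \<ge> 3"
  shows "level y \<le> 1"
proof (rule ccontr)
  assume "\<not> ?thesis"
  then have lvl: "level y \<ge> 2" by simp
  then have y: "y \<notin> C" using level_eq_0_iff[of y] by auto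
  have x: "parent y \<notin> C" using lvl parent(2)[OF y] level_eq_0_iff[of "parent y"] by auto
  have "parent (parent y) \<in> {circ ! i, circ ! (Suc i mod r)}" if i: "i < r" for i
  proof -
    let ?g = "{circ ! i, circ ! (Suc i mod r)}"
    have g: "?g \<subseteq> C" using i circ_nonempty by auto
    then have "{y, parent y} \<inter> ?g = {}" using x y by auto
    then obtain p q where pq: "p \<in> {y, parent y}" "q \<in> ?g" "{p, q} \<in> E"
      by (rule linkE[OF L parent(1)[OF y] circ_nth[OF i]])
    with g have q: "q \<in> C" "level q = 0" using level_eq_0_iff by auto
    from pq(3) have "q = parent p"
      by (rule edge_cases) (use pq x y q in auto)
    moreover from this have "p \<noteq> y" using q x by auto
    ultimately show ?thesis using pq by auto
  qed
  note mem = this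
  have ne: "circ \<noteq> []" and "Suc 0 mod r = 1" "Suc 1 mod r = 2" using r by auto
  with mem[of 0] mem[of 1] mem[of 2] r
  have "parent (parent y) \<in> {circ ! 0, circ ! 1}" "parent (parent y) \<in> {circ ! 1, circ ! 2}"
    "parent (parent y) \<in> {circ ! 2, circ ! (3 mod r)}" by (simp_all add: numeral_eq_Suc)
  moreover have "circ ! 0 \<noteq> circ ! 1" "circ ! 0 \<noteq> circ ! 2" "circ ! 1 \<noteq> circ ! 2"
    using r ne nth_circ_eq[of 0 1] nth_circ_eq[of 0 2] nth_circ_eq[of 1 2] by simp_all
  moreover have "circ ! 1 \<noteq> circ ! (3 mod r)"
    using r nth_circ_eq[of 1 "3 mod r"] by (cases "r = 3") simp_all
  ultimately show False by auto
qed

text \<open>For \<open>r = 1\<close>, linking to the loop bounds the distance by 2, and two edges between the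
  distances 1 and 2 must share their end at distance 1. For \<open>r \<ge> 3\<close> the distance is at most 1; a pendant edge
  is not linked to the opposite edge of a pentagon, and edges of a longer circuit can be linked only by
  chords. Conversely, in each of the three cases the edges are known from \<open>edges_eq\<close>.\<close>

theorem linked_edges_iff:
  "linked_edges E \<longleftrightarrow>
    (r = 1 \<and> (\<forall>j\<ge>3. nbhd_edges E C j = {}) \<and> card {x. x \<notin> C \<and> vertex_degree E x \<ge> 2} \<le> 1) \<or>
    (r = 3 \<and> (\<forall>j\<ge>2. nbhd_edges E C j = {})) \<or>
    (r = 5 \<and> (\<forall>j\<ge>1. nbhd_edges E C j = {}))"
    (is "_ \<longleftrightarrow> ?d")
proof -
  let ?S = "{x. x \<notin> C \<and> vertex_degree E x \<ge> 2}"
  have S: "card ?S \<le> 1 \<longleftrightarrow> (\<forall>x y. x \<notin> C \<longrightarrow> y \<notin> C \<longrightarrow> parent x \<notin> C \<longrightarrow> parent y \<notin> C \<longrightarrow> parent x = parent y)"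
    unfolding One_nat_def using branch_vertex_iff by (subst card_le_Suc0_iff_eq) auto
  have "?d \<longleftrightarrow> (r = 1 \<and> (\<forall>x. level x < 3) \<and> card ?S \<le> 1) \<or> (r = 3 \<and> (\<forall>x. level x < 2)) \<or> (r = 5 \<and> (\<forall>x. level x < 1))"
    by (simp only: nbhd_edges_empty_iff one_le_numeral order_refl)
  moreover have "linked_edges E \<longleftrightarrow> \<dots>"
  proof
    assume L: "linked_edges E"
    consider "r = 1" | "r = 3" | "r = 5" | "r \<ge> 7"
    proof -
      obtain m where "r = 2 * m + 1" using odd by (rule oddE)
      then have "r = 1 \<or> r = 3 \<or> r = 5 \<or> r \<ge> 7" by presburger
      then show thesis using that by blast
    qed
    then show "(r = 1 \<and> (\<forall>x. level x < 3) \<and> card ?S \<le> 1) \<or> (r = 3 \<and> (\<forall>x. level x < 2)) \<or> (r = 5 \<and> (\<forall>x. level x < 1))"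
    proof cases
      case 1
      then obtain v where circ_eq: "circ = [v]" by (auto simp: length_Suc_conv)
      have loop: "{v} \<in> E" using circ_nth[of 0] by (simp add: circ_eq)
      have lvl: "level x < 3" for x
      proof (rule ccontr)
        assume x: "\<not> level x < 3"
        then have x': "x \<notin> C" using level_eq_0_iff[of x] by auto
        then have "level (parent x) \<ge> 2" using x parent(2)[of x] by simp
        with x have "{x, parent x} \<inter> {v} = {}" using level_eq_0_iff[of v] by (auto simp: circ_eq)
        then obtain p q where pq: "p \<in> {x, parent x}" "q \<in> {v}" "{p, q} \<in> E"
          by (rule linkE[OF L parent(1)[OF x'] loop])
        then have "level p \<le> 1"
          using level_step[of v p] level_eq_0_iff[of v] by (simp add: circ_eq insert_commute)
        with pq x \<open>level (parent x) \<ge> 2\<close> show False by auto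
      qed
      have "parent x = parent y" if xy: "x \<notin> C" "y \<notin> C" "parent x \<notin> C" "parent y \<notin> C" for x y
      proof (rule ccontr)
        assume neq: "parent x \<noteq> parent y"
        have lx: "level x = 2" "level (parent x) = 1"
          using lvl[of x] parent(2)[OF xy(1)] parent(2)[OF xy(3)] by auto
        have ly: "level y = 2" "level (parent y) = 1"
          using lvl[of y] parent(2)[OF xy(2)] parent(2)[OF xy(4)] by auto
        have "{x, parent x} \<inter> {y, parent y} = {}" using lx ly neq by auto
        then obtain p q where pq: "p \<in> {x, parent x}" "q \<in> {y, parent y}" "{p, q} \<in> E"
          by (rule linkE[OF L parent(1)[OF xy(1)] parent(1)[OF xy(2)]])
        from pq(3) show False
          by (rule edge_cases) (use pq xy lx ly neq in auto)
      qed
      then show ?thesis using 1 lvl S by blast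
    next
      case 2
      then show ?thesis using linked_level_le_1[OF L] by (auto simp: less_Suc_eq_le numeral_2_eq_2)
    next
      case 3
      have "level y < 1" for y
      proof (rule ccontr)
        assume y: "\<not> level y < 1"
        then have y': "y \<notin> C" using level_eq_0_iff[of y] by auto
        have "level y \<le> 1" using linked_level_le_1[OF L] 3 by simp
        then have "parent y \<in> C" using parent(2)[OF y'] level_eq_0_iff[of "parent y"] by auto
        then obtain i where i: "i < 5" "parent y = circ ! i" using 3 by (auto simp: in_set_conv_nth)
        \<comment> \<open>The edge of the pentagon opposite to \<open>c_i\<close> cannot be linked to the edge from \<open>c_i\<close> to \<open>y\<close>.\<close>
        let ?j = "(i + 2) mod 5" and ?k = "(i + 3) mod 5"
        have jk: "?j < r" "?k < r" "?k = Suc ?j mod r"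
          by (simp_all add: 3 mod_Suc_eq add.commute[of i])
        have i_neq: "i \<noteq> ?j" "i \<noteq> ?k" "?j \<noteq> Suc i mod r" "?k \<noteq> Suc i mod r"
          "i \<noteq> Suc ?j mod r" "i \<noteq> Suc ?k mod r"
        proof -
          have "i = 0 \<or> i = 1 \<or> i = 2 \<or> i = 3 \<or> i = 4" using i(1) by arith
          then show "i \<noteq> ?j" "i \<noteq> ?k" "?j \<noteq> Suc i mod r" "?k \<noteq> Suc i mod r"
            "i \<noteq> Suc ?j mod r" "i \<noteq> Suc ?k mod r"
            unfolding 3 by (elim disjE; simp)+
        qed
        have on_circuit: "circ ! ?j \<in> C" "circ ! ?k \<in> C" using jk by (auto intro: nth_mem)
        have "circ ! i \<noteq> circ ! ?j" "circ ! i \<noteq> circ ! ?k"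
          using i_neq i(1) 3 nth_circ_eq[OF _ jk(1)] nth_circ_eq[OF _ jk(2)] by auto
        with y' on_circuit i(2) have disj: "{y, parent y} \<inter> {circ ! ?j, circ ! ?k} = {}" by auto
        have "{circ ! ?j, circ ! ?k} \<in> E" using circ_nth[OF jk(1)] by (simp only: jk(3)[symmetric])
        then obtain p q where pq: "p \<in> {y, parent y}" "q \<in> {circ ! ?j, circ ! ?k}" "{p, q} \<in> E"
          by (rule linkE[OF L parent(1)[OF y'] _ disj])
        have q: "q \<in> C" using pq(2) on_circuit by auto
        show False
        proof (cases "p = y")
          case True
          with pq(3) have "{y, q} \<in> E" by simp
          then have "q = parent y" by (rule edge_cases) (use q y' in auto)
          with disj pq(2) show False by auto
        next
          case False
          with pq i have "{circ ! i, q} \<in> E" by auto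
          with pq(2) have "{circ ! i, circ ! ?j} \<in> E \<or> {circ ! i, circ ! ?k} \<in> E" by auto
          then show False
            using no_chord[of i ?j] no_chord[of i ?k] i(1) 3 jk(1,2) i_neq by metis
        qed
      qed
      then show ?thesis using 3 by auto
    next
      case 4
      \<comment> \<open>The edges \<open>{c_0, c_1}\<close> and \<open>{c_3, c_4}\<close> could only be linked by a chord.\<close>
      have ne: "circ \<noteq> []" using 4 by auto
      have 1: "{circ ! 0, circ ! 1} \<in> E" "{circ ! 3, circ ! 4} \<in> E"
        using circ_nth[of 0] circ_nth[of 3] 4 ne by auto
      have "{circ ! 0, circ ! 1} \<inter> {circ ! 3, circ ! 4} = {}"
        using 4 ne nth_circ_eq[of 0 3] nth_circ_eq[of 0 4] nth_circ_eq[of 1 3] nth_circ_eq[of 1 4] by auto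
      then obtain p q where "p \<in> {circ ! 0, circ ! 1}" "q \<in> {circ ! 3, circ ! 4}" "{p, q} \<in> E"
        by (rule linkE[OF L 1])
      then show ?thesis
        using no_chord[of 0 3] no_chord[of 0 4] no_chord[of 1 3] no_chord[of 1 4] 4 ne by auto
    qed
  next
    assume "(r = 1 \<and> (\<forall>x. level x < 3) \<and> card ?S \<le> 1) \<or> (r = 3 \<and> (\<forall>x. level x < 2)) \<or> (r = 5 \<and> (\<forall>x. level x < 1))"
    then show "linked_edges E"
    proof (elim disjE conjE)
      assume r: "r = 1" and lvl: "\<forall>x. level x < 3" and "card ?S \<le> 1"
      then have one: "parent x = parent y"
        if "x \<notin> C" "y \<notin> C" "parent x \<notin> C" "parent y \<notin> C" for x y using S that by blast
      from r obtain v where circ_eq: "circ = [v]" by (auto simp: length_Suc_conv)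
      have edges: "v \<in> e \<or> (\<exists>x. e = {x, parent x} \<and> x \<notin> C \<and> parent x \<notin> C \<and> {parent x, v} \<in> E)"
        if e: "e \<in> E" for e
      proof (cases "v \<in> e")
        case False
        then obtain x where x: "e = {x, parent x}" "x \<notin> C"
          using e by (subst (asm) edges_eq) (auto simp: circ_eq)
        with False have px: "parent x \<notin> C" by (auto simp: circ_eq)
        have "level (parent (parent x)) = 0"
          using lvl[rule_format, of x] parent(2)[OF x(2)] parent(2)[OF px] by simp
        then have "parent (parent x) = v" using level_eq_0_iff by (simp add: circ_eq)
        with parent(1)[OF px] x px show ?thesis by auto
      qed auto
      show ?thesis
      proof (rule linked_edgesI)
        fix e f assume ef: "e \<in> E" "f \<in> E" "e \<inter> f = {}"
        from edges[OF ef(1)] edges[OF ef(2)] ef(3) one show "\<exists>p\<in>e. \<exists>q\<in>f. {p, q} \<in> E"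
          by (auto simp: insert_commute)
      qed
    next
      assume r: "r = 3" and lvl: "\<forall>x. level x < 2"
      have meet: "\<exists>p\<in>e. p \<in> C" if mem: "e \<in> E" for e
      proof -
        obtain x y where e: "e = {x, y}" using edge[OF mem] by auto
        with mem have "{x, y} \<in> E" by simp
        then show ?thesis
          by (rule edge_cases) (use lvl level_eq_0_iff e in \<open>auto simp: less_Suc_eq numeral_2_eq_2\<close>)
      qed
      have adj: "{p, q} \<in> E" if pq: "p \<in> C" "q \<in> C" "p \<noteq> q" for p q
      proof -
        from r obtain a b c where abc: "circ = [a, b, c]"
          by (auto simp: length_Suc_conv numeral_3_eq_3)
        have "{a, b} \<in> E" "{b, c} \<in> E" "{c, a} \<in> E"
          using circ_nth[of 0] circ_nth[of 1] circ_nth[of 2] by (simp_all add: abc numeral_2_eq_2)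
        moreover from this have "{b, a} \<in> E" "{c, b} \<in> E" "{a, c} \<in> E"
          by (simp_all only: insert_commute)
        moreover have "p = a \<or> p = b \<or> p = c" "q = a \<or> q = b \<or> q = c" using pq(1,2) abc by auto
        ultimately show ?thesis using pq(3) by (elim disjE) simp_all
      qed
      show ?thesis
      proof (rule linked_edgesI)
        fix e f assume ef: "e \<in> E" "f \<in> E" "e \<inter> f = {}"
        then obtain p q where pq: "p \<in> e" "q \<in> f" "p \<in> C" "q \<in> C" using meet by blast
        with ef have "p \<noteq> q" by auto
        with pq(3,4) have "{p, q} \<in> E" by (rule adj)
        with pq show "\<exists>p\<in>e. \<exists>q\<in>f. {p, q} \<in> E" by auto
      qed
    next
      assume r: "r = 5" and lvl: "\<forall>x. level x < 1"
      then have "C = UNIV" using level_eq_0_iff by auto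
      then have E: "E = (\<lambda>i. {circ ! i, circ ! (Suc i mod 5)}) ` {..<5}"
        by (subst edges_eq) (simp add: r)
      have I: "{..<5::nat} = {0, 1, 2, 3, 4}" by auto
      show ?thesis
      proof (rule linked_edgesI)
        fix e f assume ef: "e \<in> E" "f \<in> E" "e \<inter> f = {}"
        then obtain i j where ij: "i < 5" "e = {circ ! i, circ ! (Suc i mod 5)}"
          "j < 5" "f = {circ ! j, circ ! (Suc j mod 5)}" unfolding E by auto
        have step: "{circ ! k, circ ! (Suc k mod 5)} \<in> E" if "k < 5" for k using circ_nth r that by auto
        have "j \<noteq> i" "j \<noteq> Suc i mod 5" "i \<noteq> Suc j mod 5"
          using ef(3) ij by auto
        moreover have "i = 0 \<or> i = 1 \<or> i = 2 \<or> i = 3 \<or> i = 4" "j = 0 \<or> j = 1 \<or> j = 2 \<or> j = 3 \<or> j = 4"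
          using ij(1,3) by arith+
        ultimately have "j = Suc (Suc i mod 5) mod 5 \<or> i = Suc (Suc j mod 5) mod 5"
          by (elim disjE; simp)
        then show "\<exists>p\<in>e. \<exists>q\<in>f. {p, q} \<in> E"
        proof
          assume "j = Suc (Suc i mod 5) mod 5"
          with step[of "Suc i mod 5"] have "{circ ! (Suc i mod 5), circ ! j} \<in> E" by simp
          then show ?thesis using ij by blast
        next
          assume "i = Suc (Suc j mod 5) mod 5"
          with step[of "Suc j mod 5"] have "{circ ! i, circ ! (Suc j mod 5)} \<in> E"
            by (simp add: insert_commute)
          then show ?thesis using ij by blast
        qed
      qed
    qed
  qed
  ultimately show ?thesis by simp
qed

end

section \<open>The graph of a quadratic Cremona set\<close>

lemma alternating_sum_telescope:
  fixes g :: "nat \<Rightarrow> real"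
  shows "(\<Sum>i<m. (- 1) ^ i * (g i + g (Suc i))) = g 0 - (- 1) ^ m * g m"
  by (induction m) (simp_all add: algebra_simps)

context cremona_quadrics
begin

lemma monomial_graph_eq: "monomial_graph F = range (\<lambda>j. keys (F j))"
proof (intro equalityI subsetI)
  fix e assume "e \<in> monomial_graph F"
  then obtain x y j where "e = {x, y}" "F j = unit_vec x + unit_vec y"
    unfolding monomial_graph_def by blast
  then have "e = keys (F j)" by (simp only: keys_edge)
  then show "e \<in> range (\<lambda>j. keys (F j))" by blast
next
  fix e assume "e \<in> range (\<lambda>j. keys (F j))"
  then obtain j where e: "e = keys (F j)" by blast
  obtain x where "x \<in> keys (F j)" using keys_F_nonempty[of j] by blast
  then obtain y where y: "F j = unit_vec x + unit_vec y" by (rule edge_split)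
  with e have "e = {x, y}" by (simp only: keys_edge)
  with y show "e \<in> monomial_graph F" unfolding monomial_graph_def by blast
qed

lemma F_eq_if_keys_eq:
  assumes "keys (F j) = {x, y}"
  shows "F j = unit_vec x + unit_vec y"
proof -
  have "x \<in> keys (F j)" using assms by simp
  then obtain z where z: "F j = unit_vec x + unit_vec z" by (rule edge_split)
  with assms have "{x, y} = {x, z}" by (simp only: keys_edge)
  then have "y = z" by (auto simp: doubleton_eq_iff)
  with z show ?thesis by simp
qed

lemma inj_keys_F: "inj (\<lambda>j. keys (F j))"
proof (rule injI)
  fix j k assume eq: "keys (F j) = keys (F k)"
  obtain x where "x \<in> keys (F j)" using keys_F_nonempty[of j] by blast
  then obtain y where y: "F j = unit_vec x + unit_vec y" by (rule edge_split)
  then have "keys (F k) = {x, y}" by (simp only: eq[symmetric] keys_edge)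
  from F_eq_if_keys_eq[OF this] y have "F j = F k" by simp
  with inj_F show "j = k" by (rule injD)
qed

lemma linked_iff: "linked \<longleftrightarrow> linked_edges (monomial_graph F)"
  unfolding linked_def linked_edges_def monomial_graph_eq by simp

text \<open>If \<open>K\<close> is closed under adjacency, every column of \<open>A\<close> has an even sum over \<open>K\<close>, hence so has
  \<open>A (b_x - b_y) = e_x - e_y\<close>, where \<open>b_x\<close> is the column \<open>G x\<close>. For \<open>y \<in> K\<close> and \<open>x \<notin> K\<close> this sum
  is \<open>-1\<close>.\<close>

lemma graph_connected:
  assumes K: "K \<noteq> {}" "\<And>x y. {x, y} \<in> monomial_graph F \<Longrightarrow> x \<in> K \<Longrightarrow> y \<in> K"
  shows "K = UNIV"
proof (rule ccontr)
  assume "K \<noteq> UNIV"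
  with K(1) obtain x y where x: "x \<notin> K" and y: "y \<in> K" by blast
  define z where "z j = int (lookup (G x) j) - int (lookup (G y) j)" for j
  have "even (\<Sum>i\<in>K. int (lookup (F j) i))" for j
  proof (cases "keys (F j) \<inter> K = {}")
    case True
    then have "(\<Sum>i\<in>K. int (lookup (F j) i)) = 0"
      by (intro sum.neutral) (auto simp: in_keys_iff)
    then show ?thesis by simp
  next
    case False
    then obtain a where a: "a \<in> keys (F j)" "a \<in> K" by blast
    then obtain b where b: "keys (F j) = {a, b}" by (metis edge_split keys_edge)
    then have "{a, b} \<in> monomial_graph F" unfolding monomial_graph_eq by (metis rangeI)
    with K(2) a(2) have "b \<in> K" by blast
    with a b have "keys (F j) \<subseteq> K" by simp
    then have "(\<Sum>i\<in>K. lookup (F j) i) = mdeg (F j)"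
      unfolding mdeg_def by (intro sum.mono_neutral_right) (auto simp: in_keys_iff)
    then show ?thesis by (simp add: deg_F flip: of_nat_sum)
  qed
  then have "even (\<Sum>j\<in>UNIV. z j * (\<Sum>i\<in>K. int (lookup (F j) i)))"
    by (intro dvd_sum) (rule dvd_mult)
  also have "(\<Sum>j\<in>UNIV. z j * (\<Sum>i\<in>K. int (lookup (F j) i))) = (\<Sum>i\<in>K. \<Sum>j\<in>UNIV. int (lookup (F j) i) * z j)"
    unfolding sum_distrib_left by (subst sum.swap) (simp add: mult.commute)
  also have "\<dots> = (\<Sum>i\<in>K. (if i = x then 1 else 0) - (if i = y then 1 else 0))"
  proof (rule sum.cong[OF refl])
    fix i
    have "(\<Sum>j\<in>UNIV. int (lookup (F j) i) * z j) =
      int (\<Sum>j\<in>UNIV. lookup (F j) i * lookup (G x) j) - int (\<Sum>j\<in>UNIV. lookup (F j) i * lookup (G y) j)"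
      by (simp add: z_def right_diff_distrib sum_subtractf)
    then show "(\<Sum>j\<in>UNIV. int (lookup (F j) i) * z j) = (if i = x then 1 else 0) - (if i = y then 1 else 0)"
      by (simp add: inverse)
  qed
  also have "\<dots> = - 1" using x y by (simp add: sum_subtractf)
  finally show False by simp
qed

text \<open>The edges of an even circuit with alternating signs form a vector in the kernel of \<open>A\<close>.\<close>

lemma circuit_odd:
  assumes c: "circuit (monomial_graph F) c"
  shows "odd (length c)"
proof
  let ?r = "length c" and ?e = "\<lambda>i. {c ! i, c ! (Suc i mod length c)}"
  assume even: "even ?r"
  have r: "?r > 0" and mem: "\<And>i. i < ?r \<Longrightarrow> ?e i \<in> monomial_graph F"
    using c unfolding circuit_def by auto
  define z :: "'n \<Rightarrow> real" where "z j = (\<Sum>i<?r. if keys (F j) = ?e i then (- 1) ^ i else 0)" for j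
  have "z j = 0" for j
  proof (rule log_matrix_kernel)
    fix v
    define g :: "nat \<Rightarrow> real" where "g i = (if c ! (i mod ?r) = v then 1 else 0)" for i
    have "(\<Sum>j\<in>UNIV. real (lookup (F j) v) * z j) =
      (\<Sum>i<?r. \<Sum>j\<in>UNIV. if keys (F j) = ?e i then real (lookup (F j) v) * (- 1) ^ i else 0)"
      unfolding z_def sum_distrib_left by (subst sum.swap) (simp add: mult_delta_right if_distrib cong: if_cong)
    also have "\<dots> = (\<Sum>i<?r. (- 1) ^ i * (g i + g (Suc i)))"
    proof (rule sum.cong[OF refl])
      fix i assume "i \<in> {..<?r}"
      then have i: "i < ?r" by simp
      obtain k where k: "keys (F k) = ?e i" using mem[OF i] unfolding monomial_graph_eq by auto
      have "keys (F j) = ?e i \<longleftrightarrow> j = k" for j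
        using k injD[OF inj_keys_F, of j k] by auto
      then have "(\<Sum>j\<in>UNIV. if keys (F j) = ?e i then real (lookup (F j) v) * (- 1) ^ i else 0)
        = real (lookup (F k) v) * (- 1) ^ i" by simp
      also have "real (lookup (F k) v) = g i + g (Suc i)"
        unfolding F_eq_if_keys_eq[OF k] using i by (simp add: g_def lookup_add lookup_single when_def)
      finally show "(\<Sum>j\<in>UNIV. if keys (F j) = ?e i then real (lookup (F j) v) * (- 1) ^ i else 0)
        = (- 1) ^ i * (g i + g (Suc i))" by simp
    qed
    also have "\<dots> = 0"
      unfolding alternating_sum_telescope using even by (simp add: g_def)
    finally show "(\<Sum>j\<in>UNIV. real (lookup (F j) v) * z j) = 0" .
  qed
  moreover obtain k where k: "keys (F k) = ?e 0" using mem[OF r] unfolding monomial_graph_eq by auto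
  moreover have "z k = 1"
  proof -
    have "?e 0 = ?e i \<longleftrightarrow> i = 0" if "i < ?r" for i
    proof
      assume "?e 0 = ?e i"
      from inj_onD[OF circuit_edges_inj[OF c] this] that r have "0 = i" by simp
      then show "i = 0" ..
    next
      assume "i = 0"
      then show "?e 0 = ?e i" by (simp only:)
    qed
    then have "z k = (\<Sum>i<?r. if i = 0 then 1 else 0)"
      unfolding z_def k by (intro sum.cong) auto
    then show ?thesis using r by simp
  qed
  ultimately show False by simp
qed

lemma odd_unicyclic_graph:
  assumes "circuit (monomial_graph F) c"
  shows "odd_unicyclic_graph (monomial_graph F) c"
proof
  fix e assume "e \<in> monomial_graph F"
  then show "\<exists>x y. e = {x, y}" unfolding monomial_graph_def by blast
next
  show "card (monomial_graph F) = CARD('n)"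
    unfolding monomial_graph_eq by (rule card_image[OF inj_keys_F])
qed (use assms circuit_odd graph_connected in auto)

end

lemma cremona_quadricsI:
  fixes F Finv :: "'n::finite \<Rightarrow> 'n monomial"
  assumes "inj F" "\<And>j. mdeg (F j) = 2"
    and eq: "log_matrix F ** log_matrix Finv = (\<chi> i j. \<gamma> $ i) + mat 1"
  shows "cremona_quadrics F Finv (\<lambda>i. \<gamma> $ i)"
proof
  fix i v
  have "(log_matrix F ** log_matrix Finv) $ i $ v = \<gamma> $ i + (if i = v then 1 else 0)"
    unfolding eq by (simp add: mat_def)
  then show "(\<Sum>j\<in>UNIV. lookup (F j) i * lookup (Finv v) j) = \<gamma> $ i + (if i = v then 1 else 0)"
    by (simp add: matrix_matrix_mult_def log_matrix_def)
qed (use assms in auto)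

theorem proposition2p5:
  fixes F Finv :: "'n::finite \<Rightarrow> 'n monomial"
    and circ :: "'n list" and r s :: nat and sj :: "nat \<Rightarrow> nat"
  assumes "CARD('n) \<ge> 2"
    and "cremona_set TYPE('k::field) F"
    and "\<forall>j. mdeg (F j) = 2"
    and "canonical_restrictions F"
    and "cremona_inverse F Finv"
    and "circuit (monomial_graph F) circ"
    and "r = length circ"
    and "s = card {x. x \<notin> set circ \<and> vertex_degree (monomial_graph F) x \<ge> 2}"
    and "\<forall>j\<ge>1. sj j = card (nbhd_edges (monomial_graph F) (set circ) j)"
  defines "a \<equiv> linear_type (ideal_of (range (\<lambda>j. mono_poly (Finv j) :: ('n, 'k) mpoly)))"
    and "b \<equiv> linearly_presented (\<lambda>j. mono_poly (F j) :: ('n, 'k) mpoly)"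
    and "c \<equiv> graph_diameter (monomial_graph F) (edge_graph_adj (monomial_graph F)) \<le> 2"
    and "d \<equiv> (r = 1 \<and> (\<forall>j\<ge>3. sj j = 0) \<and> s \<le> 1) \<or>
             (r = 3 \<and> (\<forall>j\<ge>2. sj j = 0)) \<or>
             (r = 5 \<and> (\<forall>j\<ge>1. sj j = 0))"
  shows "(a \<longleftrightarrow> b) \<and> (b \<longleftrightarrow> c) \<and> (c \<longleftrightarrow> d)"
proof -
  let ?E = "monomial_graph F"
  obtain \<gamma> :: "nat ^ 'n" where "log_matrix F ** log_matrix Finv = (\<chi> i j. \<gamma> $ i) + mat 1"
    using assms(5) unfolding cremona_inverse_def by blast
  moreover have "inj F" using assms(2) unfolding cremona_set_def monomial_set_def by blast
  ultimately interpret cremona_quadrics F Finv "\<lambda>i. \<gamma> $ i"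
    using assms(3) by (intro cremona_quadricsI) auto
  interpret odd_unicyclic_graph ?E circ
    by (rule odd_unicyclic_graph[OF assms(6)])
  have "a \<longleftrightarrow> linked"
    unfolding a_def using linked_imp_linear_type linear_type_imp_linked by blast
  moreover have "b \<longleftrightarrow> linked"
    unfolding b_def using linked_imp_linearly_presented linearly_presented_imp_linked by blast
  moreover have "c \<longleftrightarrow> linked"
    unfolding c_def linked_iff
  proof (rule edge_graph_diameter_le_2_iff)
    show "{} \<notin> ?E"
      unfolding monomial_graph_eq using keys_F_nonempty by (metis imageE)
  qed
  moreover have "sj j = 0 \<longleftrightarrow> nbhd_edges ?E (set circ) j = {}" if "j \<ge> 1" for j
    using assms(9) that by simp
  then have "d \<longleftrightarrow> linked"
    unfolding d_def linked_iff linked_edges_iff assms(7,8)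
    by (metis One_nat_def Suc_leI le_trans one_le_numeral order_refl)
  ultimately show ?thesis by blast
qed

end
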